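(* For any $f\in\mathcal{H}$, one has \[ G_f=F_{S(f)} . \]
   Context: $\mathcal{A}=\mathbb{Q}\langle x,y\rangle$ is the noncommutative polynomial algebra over $\mathbb{Q}$ in two indeterminates $x,y$. For $u\in\mathcal{A}$, $L_u,R_u:\mathcal{A}\to\mathcal{A}$ are the $\mathbb{Q}$-linear maps $L_u(w)=uw$, $R_u(w)=wu$; $L_y^{-1}:y\mathcal{A}\to\mathcal{A}$ is the inverse of $L_y:\mathcal{A}\to y\mathcal{A}$. Hopf algebra $\mathcal{H}$. A rooted tree is a finite (nonempty, non-planar) tree with a distinguished root; a forest is a finite commutative product $t_1\cdots t_n$ of rooted trees; $\mathbb{I}$ is the empty forest. $\mathcal{H}$ (Connes–Kreimer Hopf algebra) is the $\mathbb{Q}$-vector space with basis the forests, with commutative multiplication of forests and unit $\mathbb{I}$. The linear map $B_+:\mathcal{H}\to\mathcal{H}$ sends a forest to the rooted tree obtained by grafting all its roots onto a common new root; $B_+(\mathbb{I})=\bullet$ is the one-vertex tree. Every rooted tree is $B_+(f)$ for a unique forest $f$. The coproduct $\Delta$ is the algebra homomorphism ($\Delta(gh)=\Delta(g)\Delta(h)$, $\Delta(\mathbb{I})=\mathbb{I}\otimes\mathbb{I}$) with $\Delta(t)=\mathbb{I}\otimes t+(B_+\otimes\mathrm{id})(\Delta(f))$ for a tree $t=B_+(f)$. $S$ denotes the antipode of $\mathcal{H}$. Product $\diamond$. The $\mathbb{Q}$-bilinear, commutative, associative product $\diamond$ on $\mathcal{A}$ is defined by $w\diamond 1=1\diamond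 w=w$ and $xw_1\diamond xw_2=x(w_1\diamond xw_2)-x(yw_1\diamond w_2)$, $xw_1\diamond yw_2=x(w_1\diamond yw_2)+y(xw_1\diamond w_2)$, $yw_1\diamond xw_2=y(w_1\diamond xw_2)+x(yw_1\diamond w_2)$, $yw_1\diamond yw_2=y(w_1\diamond yw_2)-y(xw_1\diamond w_2)$ for $w,w_1,w_2\in\mathcal{A}$. Polynomials $F_f$ and $G_f$. For a forest $f$, $F_f,G_f\in\mathbb{Q}+y\mathcal{A}$ are defined recursively by: $F_{\mathbb{I}}=1$; $F_{\bullet}=y$; $F_t=L_yL_{x+2y}L_y^{-1}(F_f)$ if $t=B_+(f)$ is a tree and $f\neq\mathbb{I}$; $F_f=F_g\diamond F_h$ if $f=gh$; and $G_{\mathbb{I}}=1$; $G_{\bullet}=-y$; $G_t=R_{2x+y}(G_f)=G_f\,(2x+y)$ if $t=B_+(f)$ is a tree and $f\neq\mathbb{I}$; $G_f=G_g\diamond G_h$ if $f=gh$. Both are extended linearly to $f\in\mathcal{H}$. *)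

theory Defs
  imports Complex_Main "HOL-Library.Poly_Mapping" "HOL-Library.Multiset" "HOL-Library.Product_Plus"
begin

section \<open>Vector spaces with a given basis\<close>

text \<open>
  The \<open>\<rat>\<close>-vector space with basis \<open>'a\<close> is \<^typ>\<open>'a \<Rightarrow>\<^sub>0 rat\<close>, the finitely supported functions
  \<open>'a \<Rightarrow> rat\<close>. If \<open>'a\<close> is an (additively written) monoid, the library multiplication on this
  type is that of the monoid algebra.
\<close>

definition scale :: "rat \<Rightarrow> ('a \<Rightarrow>\<^sub>0 rat) \<Rightarrow> ('a \<Rightarrow>\<^sub>0 rat)" where
  "scale c p = Poly_Mapping.map ((*) c) p"

abbreviation basis :: "'a \<Rightarrow> ('a \<Rightarrow>\<^sub>0 rat)" where
  "basis a \<equiv> Poly_Mapping.single a 1"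

definition lin_ext :: "('a \<Rightarrow> ('b \<Rightarrow>\<^sub>0 rat)) \<Rightarrow> ('a \<Rightarrow>\<^sub>0 rat) \<Rightarrow> ('b \<Rightarrow>\<^sub>0 rat)" where
  "lin_ext g p = (\<Sum>a\<in>Poly_Mapping.keys p. scale (Poly_Mapping.lookup p a) (g a))"

lemma lookup_scale [simp]:
  "Poly_Mapping.lookup (scale c p) a = c * Poly_Mapping.lookup p a"
  unfolding scale_def by transfer (simp add: when_def)

lemma vector_space_scale: "vector_space scale"
  by unfold_locales
    (auto intro!: poly_mapping_eqI simp: lookup_add algebra_simps)

lemma scale_simps [simp]:
  "scale c 0 = 0" "scale 0 p = 0" "scale 1 p = p" "scale c (scale d p) = scale (c * d) p"
  "scale c (- p) = - scale c p"
  "scale c (Poly_Mapping.single a d) = Poly_Mapping.single a (c * d)"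
  by (auto intro!: poly_mapping_eqI simp: lookup_single when_def)

lemma scale_distribs:
  "scale c (p + q) = scale c p + scale c q"
  "scale c (p - q) = scale c p - scale c q"
  "scale (c + d) p = scale c p + scale d p"
  by (auto intro!: poly_mapping_eqI simp: lookup_add lookup_minus algebra_simps)

lemma scale_sum: "scale c (sum g T) = (\<Sum>a\<in>T. scale c (g a))"
  by (induction T rule: infinite_finite_induct) (auto simp: scale_distribs)

lemma scale_conv_mult: "scale c p = Poly_Mapping.single 0 c * p"
  for p :: "'a::monoid_add \<Rightarrow>\<^sub>0 rat"
  unfolding scale_def by (rule mult_map_scale_conv_mult)

lemma basis_induct [case_names add scale basis]:
  fixes p :: "'a \<Rightarrow>\<^sub>0 rat"
  assumes "\<And>p q. P p \<Longrightarrow> P q \<Longrightarrow> P (p + q)" "\<And>c p. P p \<Longrightarrow> P (scale c p)" "\<And>a. P (basis a)"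
  shows "P p"
proof (induction p rule: update_induct)
  case const
  have "P (scale 0 (basis undefined))" by (intro assms)
  thus ?case by simp
next
  case (update p a b)
  have "Poly_Mapping.update a b p = p + scale b (basis a)"
    using update.hyps
    by (auto intro!: poly_mapping_eqI simp: lookup_update lookup_add lookup_single when_def
        not_in_keys_iff_lookup_eq_zero)
  with update.IH assms show ?case by metis
qed

lemma lin_ext_superset:
  assumes "finite T" "Poly_Mapping.keys p \<subseteq> T"
  shows "lin_ext g p = (\<Sum>a\<in>T. scale (Poly_Mapping.lookup p a) (g a))"
  unfolding lin_ext_def
  by (rule sum.mono_neutral_left) (use assms in \<open>auto simp: in_keys_iff\<close>)

lemma lin_ext_basis [simp]: "lin_ext g (basis a) = g a"
  by (simp add: lin_ext_def)

lemma lin_ext_one [simp]: "lin_ext g 1 = g 0"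
  using lin_ext_basis[of g 0] by (simp del: lin_ext_basis)

lemma lin_ext_add [simp]: "lin_ext g (p + q) = lin_ext g p + lin_ext g q"
proof -
  let ?T = "Poly_Mapping.keys p \<union> Poly_Mapping.keys q"
  have "Poly_Mapping.keys (p + q) \<subseteq> ?T" by (rule Poly_Mapping.keys_add)
  then show ?thesis
    using lin_ext_superset[of ?T p g] lin_ext_superset[of ?T q g] lin_ext_superset[of ?T "p + q" g]
    by (simp add: lookup_add scale_distribs sum.distrib)
qed

lemma lin_ext_scale [simp]: "lin_ext g (scale c p) = scale c (lin_ext g p)"
proof -
  have "Poly_Mapping.keys (scale c p) \<subseteq> Poly_Mapping.keys p"
    by (auto simp: in_keys_iff)
  then show ?thesis
    using lin_ext_superset[of "Poly_Mapping.keys p" "scale c p" g]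
    by (simp add: lin_ext_def scale_sum)
qed

lemma lin_ext_minus [simp]: "lin_ext g (- p) = - lin_ext g p"
proof -
  have "scale (- 1) q = - q" for q :: "'c \<Rightarrow>\<^sub>0 rat"
    by (rule poly_mapping_eqI) simp
  then show ?thesis using lin_ext_scale[of g "- 1" p] by metis
qed

lemma lin_ext_diff [simp]: "lin_ext g (p - q) = lin_ext g p - lin_ext g q"
  using lin_ext_add[of g p "- q"] by simp


section \<open>Words and the algebra \<open>\<rat>\<langle>x,y\<rangle>\<close>\<close>

instantiation list :: (type) monoid_add
begin
definition zero_list :: "'a list" where "zero_list = []"
definition plus_list :: "'a list \<Rightarrow> 'a list \<Rightarrow> 'a list" where "plus_list u v = u @ v"
instance by standard (simp_all add: zero_list_def plus_list_def)
end

datatype letter = X | Y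

type_synonym word_alg = "letter list \<Rightarrow>\<^sub>0 rat"

definition var_x :: word_alg where "var_x = basis [X]"
definition var_y :: word_alg where "var_y = basis [Y]"

definition L :: "word_alg \<Rightarrow> word_alg \<Rightarrow> word_alg" where "L u w = u * w"
definition R :: "word_alg \<Rightarrow> word_alg \<Rightarrow> word_alg" where "R u w = w * u"

text \<open>\<open>L var_y\<close> is injective, so \<open>inv (L var_y)\<close> is its inverse on the range \<open>y\<A>\<close>; its values
  elsewhere are unspecified.\<close>

definition Ly_inv :: "word_alg \<Rightarrow> word_alg" where "Ly_inv = inv (L var_y)"


subsection \<open>The product \<open>\<diamondop>\<close>\<close>

fun diamond_word :: "letter list \<Rightarrow> letter list \<Rightarrow> word_alg" where
  "diamond_word [] v = basis v"
| "diamond_word (a # u) [] = basis (a # u)"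
| "diamond_word (X # u) (X # v) = var_x * diamond_word u (X # v) - var_x * diamond_word (Y # u) v"
| "diamond_word (X # u) (Y # v) = var_x * diamond_word u (Y # v) + var_y * diamond_word (X # u) v"
| "diamond_word (Y # u) (X # v) = var_y * diamond_word u (X # v) + var_x * diamond_word (Y # u) v"
| "diamond_word (Y # u) (Y # v) = var_y * diamond_word u (Y # v) - var_y * diamond_word (X # u) v"

definition diamond :: "word_alg \<Rightarrow> word_alg \<Rightarrow> word_alg"  (infixl \<open>\<diamondop>\<close> 70) where
  "p \<diamondop> q = lin_ext (\<lambda>u. lin_ext (\<lambda>v. diamond_word u v) q) p"

lemma diamond_basis [simp]: "basis u \<diamondop> basis v = diamond_word u v"
  by (simp add: diamond_def)

lemma diamond_linear_left [simp]:
  "(p + q) \<diamondop> r = p \<diamondop> r + q \<diamondop> r" "(p - q) \<diamondop> r = p \<diamondop> r - q \<diamondop> r" "scale c p \<diamondop> r = scale c (p \<diamondop> r)"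
  by (simp_all add: diamond_def)

lemma diamond_linear_right [simp]:
  "r \<diamondop> (p + q) = r \<diamondop> p + r \<diamondop> q" "r \<diamondop> (p - q) = r \<diamondop> p - r \<diamondop> q" "r \<diamondop> scale c p = scale c (r \<diamondop> p)"
proof -
  show add: "r \<diamondop> (p + q) = r \<diamondop> p + r \<diamondop> q" for p q
    by (simp add: diamond_def lin_ext_def[of _ r] scale_distribs sum.distrib)
  show "r \<diamondop> scale c p = scale c (r \<diamondop> p)"
    by (simp add: diamond_def lin_ext_def[of _ r] scale_sum mult.commute)
  show "r \<diamondop> (p - q) = r \<diamondop> p - r \<diamondop> q"
    using add[of "p - q" q] by (simp add: eq_diff_eq)
qed

lemma one_conv_basis: "(1 :: word_alg) = basis []"
  by (metis single_one zero_list_def)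

lemma mult_basis_word: "basis u * basis v = basis (u @ v)"
  for u v :: "letter list"
  by (simp add: mult_single plus_list_def)

lemma basis_Cons: "basis (X # u) = var_x * basis u" "basis (Y # u) = var_y * basis u"
  by (simp_all add: var_x_def var_y_def mult_basis_word)

lemma mult_scale:
  "p * scale c q = scale c (p * q)" "scale c p * q = scale c (p * q)"
  for p q :: word_alg
proof -
  show left: "scale c p * q = scale c (p * q)" for c p q
    by (simp add: scale_conv_mult mult.assoc)
  have "p * Poly_Mapping.single 0 c = Poly_Mapping.single 0 c * p"
  proof (induction p rule: basis_induct)
    case (scale d p)
    have "Poly_Mapping.single 0 c * scale d p = scale d (Poly_Mapping.single 0 c * p)"
      by (simp add: scale_conv_mult mult.assoc[symmetric] mult_single mult.commute)
    with scale show ?case by (simp add: left)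
  qed (simp_all add: distrib_left distrib_right mult_single)
  then show "p * scale c q = scale c (p * q)"
    by (simp add: scale_conv_mult mult.assoc[symmetric])
qed

lemma Ly_inv_Ly [simp]: "Ly_inv (L var_y p) = p"
proof -
  have "lin_ext (\<lambda>w. basis (tl w)) (L var_y p) = p" for p
    by (induction p rule: basis_induct)
      (simp_all add: L_def distrib_left mult_scale flip: basis_Cons)
  then have "inj (L var_y)" by (metis injI)
  then show ?thesis by (simp add: Ly_inv_def)
qed

lemma diamond_one_left: "1 \<diamondop> w = w"
  by (induction w rule: basis_induct) (simp_all add: one_conv_basis)

lemma diamond_one_right: "w \<diamondop> 1 = w"
proof (induction w rule: basis_induct)
  case (basis u)
  then show ?case by (cases u) (simp_all add: one_conv_basis)
qed simp_all

lemma bilinear_cong: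
  fixes f g :: "word_alg \<Rightarrow> word_alg \<Rightarrow> word_alg"
  assumes "\<And>p p' q. f (p + p') q = f p q + f p' q" "\<And>c p q. f (scale c p) q = scale c (f p q)"
    "\<And>p q q'. f p (q + q') = f p q + f p q'" "\<And>c p q. f p (scale c q) = scale c (f p q)"
    "\<And>p p' q. g (p + p') q = g p q + g p' q" "\<And>c p q. g (scale c p) q = scale c (g p q)"
    "\<And>p q q'. g p (q + q') = g p q + g p q'" "\<And>c p q. g p (scale c q) = scale c (g p q)"
    "\<And>u v. f (basis u) (basis v) = g (basis u) (basis v)"
  shows "f p q = g p q"
proof -
  have "f (basis u) q = g (basis u) q" for u
    by (induction q rule: basis_induct) (simp_all add: assms)
  then show ?thesis by (induction p rule: basis_induct) (simp_all add: assms)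
qed

lemma diamond_rules:
  "(var_x * p) \<diamondop> (var_x * q) = var_x * (p \<diamondop> (var_x * q)) - var_x * ((var_y * p) \<diamondop> q)"
  "(var_x * p) \<diamondop> (var_y * q) = var_x * (p \<diamondop> (var_y * q)) + var_y * ((var_x * p) \<diamondop> q)"
  "(var_y * p) \<diamondop> (var_x * q) = var_y * (p \<diamondop> (var_x * q)) + var_x * ((var_y * p) \<diamondop> q)"
  "(var_y * p) \<diamondop> (var_y * q) = var_y * (p \<diamondop> (var_y * q)) - var_y * ((var_x * p) \<diamondop> q)"
  by ((rule bilinear_cong[where p = p and q = q];
      simp add: algebra_simps mult_scale scale_distribs flip: basis_Cons)+)

lemma diamond_z_left: "((var_x + var_y) * p) \<diamondop> q = (var_x + var_y) * (p \<diamondop> q)"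
proof (rule bilinear_cong[where p = p and q = q])
  fix u v :: "letter list"
  show "((var_x + var_y) * basis u) \<diamondop> basis v = (var_x + var_y) * (basis u \<diamondop> basis v)"
  proof (cases v)
    case Nil
    then show ?thesis by (simp flip: one_conv_basis add: diamond_one_right)
  next
    case (Cons a w)
    then show ?thesis
      by (cases a) (simp_all only: basis_Cons diamond_rules diamond_linear_left distrib_right,
          simp_all add: algebra_simps)
  qed
qed (simp_all add: algebra_simps mult_scale scale_distribs)

lemma diamond_commute: "p \<diamondop> q = q \<diamondop> p"
proof -
  have "basis u \<diamondop> basis v = basis v \<diamondop> basis u" for u v
  proof (induction "length u + length v" arbitrary: u v rule: less_induct)
    case less
    show ?case
    proof (cases u; cases v)
      fix a u' b v' assume uv: "u = a # u'" "v = b # v'"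
      have 1: "basis (X # u') \<diamondop> basis v' = basis v' \<diamondop> basis (X # u')"
        "basis (Y # u') \<diamondop> basis v' = basis v' \<diamondop> basis (Y # u')"
        "basis u' \<diamondop> basis (X # v') = basis (X # v') \<diamondop> basis u'"
        "basis u' \<diamondop> basis (Y # v') = basis (Y # v') \<diamondop> basis u'"
        "basis u' \<diamondop> basis v' = basis v' \<diamondop> basis u'"
        by (rule less.hyps; simp add: uv)+
      have 2: "(var_x * basis u') \<diamondop> basis v' + (var_y * basis u') \<diamondop> basis v' = (var_x + var_y) * (basis u' \<diamondop> basis v')"
        "(var_x * basis v') \<diamondop> basis u' + (var_y * basis v') \<diamondop> basis u' = (var_x + var_y) * (basis v' \<diamondop> basis u')"
        by (metis diamond_z_left distrib_right diamond_linear_left(1))+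
      show ?thesis
        unfolding uv
      proof (cases a; cases b)
        assume ab: "a = X" "b = X"
        have "basis u' \<diamondop> (var_x * basis v') - (var_y * basis u') \<diamondop> basis v'
            = basis v' \<diamondop> (var_x * basis u') - (var_y * basis v') \<diamondop> basis u'"
          using 1 2 by (simp only: basis_Cons) (simp add: algebra_simps)
        then show "basis (a # u') \<diamondop> basis (b # v') = basis (b # v') \<diamondop> basis (a # u')"
          unfolding ab by (simp only: basis_Cons diamond_rules flip: right_diff_distrib)
      next
        assume ab: "a = Y" "b = Y"
        have "basis u' \<diamondop> (var_y * basis v') - (var_x * basis u') \<diamondop> basis v'
            = basis v' \<diamondop> (var_y * basis u') - (var_x * basis v') \<diamondop> basis u'"
          using 1 2 by (simp only: basis_Cons) (simp add: algebra_simps)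
        then show "basis (a # u') \<diamondop> basis (b # v') = basis (b # v') \<diamondop> basis (a # u')"
          unfolding ab by (simp only: basis_Cons diamond_rules flip: right_diff_distrib)
      qed (use 1 in \<open>simp_all only: basis_Cons diamond_rules add.commute\<close>)
    qed (simp_all flip: one_conv_basis add: diamond_one_left diamond_one_right del: diamond_basis)
  qed
  then show ?thesis
    by (intro bilinear_cong[where p = p and q = q and g = "\<lambda>p q. q \<diamondop> p"]) auto
qed

lemma diamond_z_right: "p \<diamondop> ((var_x + var_y) * q) = (var_x + var_y) * (p \<diamondop> q)"
  by (metis diamond_commute diamond_z_left)

lemma diamond_assoc: "(p \<diamondop> q) \<diamondop> r = p \<diamondop> (q \<diamondop> r)"
proof -
  define A where "A p q r \<longleftrightarrow> (p \<diamondop> q) \<diamondop> r = p \<diamondop> (q \<diamondop> r)" for p q r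
  let ?z = "var_x + var_y"
  have zx: "var_x * p = ?z * p - var_y * p" for p by (simp add: algebra_simps)
  have x1: "A (var_x * p) q r" if "A p q r" "A (var_y * p) q r" for p q r
    using that unfolding A_def zx by (simp only: diamond_linear_left diamond_linear_right diamond_z_left)
  have x2: "A p (var_x * q) r" if "A p q r" "A p (var_y * q) r" for p q r
    using that unfolding A_def zx
    by (simp only: diamond_linear_left diamond_linear_right diamond_z_left diamond_z_right)
  have x3: "A p q (var_x * r)" if "A p q r" "A p q (var_y * r)" for p q r
    using that unfolding A_def zx by (simp only: diamond_linear_right diamond_z_right)
  have yyy: "A (var_y * u) (var_y * v) (var_y * w)"
    if "A u (var_y * v) (var_y * w)" "A (var_x * u) v (var_y * w)" "A (var_y * u) (var_y * v) w"
      "A u (var_y * v) w" "A (var_x * u) v w" for u v w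
  proof -
    note ih = that[unfolded A_def]
    define D where "D = u \<diamondop> (var_y * v) - (var_x * u) \<diamondop> v"
    define E where "E = v \<diamondop> (var_y * w) - (var_x * v) \<diamondop> w"
    have D: "(var_y * u) \<diamondop> (var_y * v) = var_y * D"
      by (simp add: D_def diamond_rules right_diff_distrib)
    have E: "(var_y * v) \<diamondop> (var_y * w) = var_y * E"
      by (simp add: E_def diamond_rules right_diff_distrib)
    have 1: "D \<diamondop> (var_y * w) = u \<diamondop> ((var_y * v) \<diamondop> (var_y * w)) - (var_x * u) \<diamondop> (v \<diamondop> (var_y * w))"
      by (simp only: D_def diamond_linear_left ih)
    have "(var_x * D) \<diamondop> w = ?z * (D \<diamondop> w) - (var_y * D) \<diamondop> w"
      by (simp only: zx diamond_linear_left diamond_z_left)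
    also have "(var_y * D) \<diamondop> w = (var_y * u) \<diamondop> ((var_y * v) \<diamondop> w)"
      by (simp only: D[symmetric] ih)
    also have "?z * (D \<diamondop> w) = (?z * u) \<diamondop> ((var_y * v) \<diamondop> w) - (var_x * u) \<diamondop> ((?z * v) \<diamondop> w)"
      by (simp only: D_def diamond_linear_left ih right_diff_distrib diamond_z_left diamond_z_right)
    finally have 2: "(var_x * D) \<diamondop> w = - ((var_x * u) \<diamondop> ((var_x * v) \<diamondop> w))"
      by (simp add: distrib_right)
    have "D \<diamondop> (var_y * w) - (var_x * D) \<diamondop> w = u \<diamondop> (var_y * E) - (var_x * u) \<diamondop> E"
      by (simp add: 1 2 E E_def)
    then have "(var_y * D) \<diamondop> (var_y * w) = (var_y * u) \<diamondop> (var_y * E)"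
      by (simp only: diamond_rules flip: right_diff_distrib)
    then show ?thesis by (simp only: A_def D E)
  qed
  have "A (basis u) (basis v) (basis w)" for u v w
  proof (induction "length u + length v + length w" arbitrary: u v w rule: less_induct)
    case less
    show ?case
    proof (cases "u = [] \<or> v = [] \<or> w = []")
      case True
      then show ?thesis
        by (auto simp: A_def diamond_one_left diamond_one_right simp del: diamond_basis simp flip: one_conv_basis)
    next
      case False
      then obtain a u' b v' c w' where e: "u = a # u'" "v = b # v'" "w = c # w'"
        by (metis neq_Nil_conv)
      have ih: "A (basis u1) (basis v1) (basis w1)"
        if "length u1 + length v1 + length w1 < length u' + length v' + length w' + 3" for u1 v1 w1
        using that less.hyps e by simp
      have Y3: "A (basis (Y # u')) (basis (Y # v')) (basis (Y # w'))"
        unfolding basis_Cons by (rule yyy; unfold basis_Cons[symmetric]; rule ih; simp)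
      have Y2: "A (basis (a # u')) (basis (Y # v')) (basis (Y # w'))"
      proof (cases a)
        case X
        have "A (basis u') (basis (Y # v')) (basis (Y # w'))" by (rule ih) simp
        then show ?thesis using Y3 x1 X by (metis basis_Cons)
      qed (use Y3 in simp)
      have Y1: "A (basis (a # u')) (basis (b # v')) (basis (Y # w'))"
      proof (cases b)
        case X
        have "A (basis (a # u')) (basis v') (basis (Y # w'))" by (rule ih) simp
        then show ?thesis using Y2 x2 X by (metis basis_Cons)
      qed (use Y2 in simp)
      show ?thesis
      proof (cases c)
        case X
        have "A (basis (a # u')) (basis (b # v')) (basis w')" by (rule ih) simp
        then show ?thesis using Y1 x3 X e by (metis basis_Cons)
      qed (use Y1 e in simp)
    qed
  qed
  then have "A (basis u) (basis v) r" for u v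
    by (induction r rule: basis_induct) (simp_all add: A_def)
  then have "A (basis u) q r" for u
    by (induction q rule: basis_induct) (simp_all add: A_def)
  then have "A p q r"
    by (induction p rule: basis_induct) (simp_all add: A_def)
  then show ?thesis by (simp add: A_def)
qed

definition diamond_mset :: "word_alg multiset \<Rightarrow> word_alg" where
  "diamond_mset M = fold_mset (\<diamondop>) 1 M"

lemma diamond_left_commute: "p \<diamondop> (q \<diamondop> r) = q \<diamondop> (p \<diamondop> r)"
  by (simp only: diamond_assoc[symmetric] diamond_commute[of p q])

interpretation diamond: comp_fun_commute "(\<diamondop>)"
  by standard (simp add: fun_eq_iff diamond_left_commute)

lemma diamond_mset_simps [simp]:
  "diamond_mset {#} = 1" "diamond_mset (add_mset p M) = p \<diamondop> diamond_mset M"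
  "diamond_mset (M + N) = diamond_mset M \<diamondop> diamond_mset N"
proof -
  show *: "diamond_mset {#} = 1" "diamond_mset (add_mset p M) = p \<diamondop> diamond_mset M" for p M
    by (simp_all add: diamond_mset_def)
  show "diamond_mset (M + N) = diamond_mset M \<diamondop> diamond_mset N"
    by (induction M) (simp_all add: * diamond_one_left diamond_assoc)
qed


section \<open>The Connes--Kreimer Hopf algebra\<close>

datatype tree = B_plus "tree multiset"

type_synonym forest = "tree multiset"

text \<open>
  Union of multisets is the product of forests, so the library multiplication on
  \<^typ>\<open>forest \<Rightarrow>\<^sub>0 rat\<close> is the product of the Hopf algebra. Its tensor square is the vector space
  with basis the pairs of forests, \<open>f \<otimes> g\<close> being \<^term>\<open>basis (f, g)\<close>; the library
  multiplication there is the componentwise one.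
\<close>

type_synonym hopf = "forest \<Rightarrow>\<^sub>0 rat"
type_synonym hopf2 = "forest \<times> forest \<Rightarrow>\<^sub>0 rat"

definition tensor :: "hopf \<Rightarrow> hopf \<Rightarrow> hopf2" where
  "tensor p q = lin_ext (\<lambda>f. lin_ext (\<lambda>g. basis (f, g)) q) p"

definition tensor_map :: "(hopf \<Rightarrow> hopf) \<Rightarrow> (hopf \<Rightarrow> hopf) \<Rightarrow> hopf2 \<Rightarrow> hopf2" where
  "tensor_map \<phi> \<psi> = lin_ext (\<lambda>(f, g). tensor (\<phi> (basis f)) (\<psi> (basis g)))"

definition B_plus_lin :: "hopf \<Rightarrow> hopf" where
  "B_plus_lin = lin_ext (\<lambda>f. basis {#B_plus f#})"

primrec coproduct_tree :: "tree \<Rightarrow> hopf2" where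
  "coproduct_tree (B_plus f) =
     basis ({#}, {#B_plus f#}) +
     tensor_map B_plus_lin id (\<Prod>\<^sub># (image_mset coproduct_tree f))"

definition coproduct_forest :: "forest \<Rightarrow> hopf2" where
  "coproduct_forest f = (\<Prod>t\<in>#f. coproduct_tree t)"

definition coproduct :: "hopf \<Rightarrow> hopf2" where
  "coproduct = lin_ext coproduct_forest"

definition mult_map :: "hopf2 \<Rightarrow> hopf" where
  "mult_map = lin_ext (\<lambda>(f, g). basis (f + g))"

definition counit :: "hopf \<Rightarrow> rat" where
  "counit p = Poly_Mapping.lookup p {#}"

text \<open>The antipode is the inverse of the identity under convolution of linear maps.\<close>

definition is_antipode :: "(hopf \<Rightarrow> hopf) \<Rightarrow> bool" where
  "is_antipode S \<longleftrightarrow> Vector_Spaces.linear scale scale S \<and>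
     (\<forall>p. mult_map (tensor_map S id (coproduct p)) = scale (counit p) 1 \<and>
          mult_map (tensor_map id S (coproduct p)) = scale (counit p) 1)"

definition antipode :: "hopf \<Rightarrow> hopf" where
  "antipode = (THE S. is_antipode S)"

lemma coproduct_tree_eq:
  "coproduct (basis {#B_plus f#}) =
     tensor 1 (basis {#B_plus f#}) + tensor_map B_plus_lin id (coproduct (basis f))"
  by (simp add: coproduct_def coproduct_forest_def tensor_def)

lemma coproduct_one: "coproduct 1 = 1"
  by (simp add: coproduct_def coproduct_forest_def zero_prod_def[symmetric])

lemma coproduct_mult: "coproduct (p * q) = coproduct p * coproduct q"
proof -
  have s: "scale c p * q = scale c (p * q)" "q * scale c p = scale c (q * p)"
    for c and p q :: "'b::comm_monoid_add \<Rightarrow>\<^sub>0 rat"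
    by (simp_all add: scale_conv_mult mult_ac)
  have "coproduct (basis f * q) = coproduct (basis f) * coproduct q" for f
    by (induction q rule: basis_induct)
      (simp_all add: coproduct_def coproduct_forest_def mult_single distrib_left s)
  then show ?thesis
    by (induction p rule: basis_induct) (simp_all add: coproduct_def distrib_right s)
qed


section \<open>The polynomials \<open>F\<close> and \<open>G\<close>\<close>

primrec F_tree :: "tree \<Rightarrow> word_alg" where
  "F_tree (B_plus f) =
     (if f = {#} then var_y
      else L var_y (L (var_x + 2 * var_y) (Ly_inv (diamond_mset (image_mset F_tree f)))))"

definition F_forest :: "forest \<Rightarrow> word_alg" where
  "F_forest f = diamond_mset (image_mset F_tree f)"

definition F :: "hopf \<Rightarrow> word_alg" where
  "F = lin_ext F_forest"

primrec G_tree :: "tree \<Rightarrow> word_alg" where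
  "G_tree (B_plus f) =
     (if f = {#} then - var_y
      else R (2 * var_x + var_y) (diamond_mset (image_mset G_tree f)))"

definition G_forest :: "forest \<Rightarrow> word_alg" where
  "G_forest f = diamond_mset (image_mset G_tree f)"

definition G :: "hopf \<Rightarrow> word_alg" where
  "G = lin_ext G_forest"

lemma F_forest_rules:
  "F_forest {#} = 1"
  "F_forest {#B_plus {#}#} = var_y"
  "f \<noteq> {#} \<Longrightarrow> F_forest {#B_plus f#} = L var_y (L (var_x + 2 * var_y) (Ly_inv (F_forest f)))"
  "F_forest (g + h) = F_forest g \<diamondop> F_forest h"
  by (simp_all add: F_forest_def diamond_one_right)

lemma G_forest_rules:
  "G_forest {#} = 1"
  "G_forest {#B_plus {#}#} = - var_y"
  "f \<noteq> {#} \<Longrightarrow> G_forest {#B_plus f#} = R (2 * var_x + var_y) (G_forest f)"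
  "G_forest (g + h) = G_forest g \<diamondop> G_forest h"
  by (simp_all add: G_forest_def diamond_one_right)

end

theory Submission
  imports Defs
begin

text \<open>
  With \<open>z = x + y\<close>, the product \<open>\<diamondop>\<close> on \<open>\<rat> + y\<A>\<close> is a quasi-shuffle product of words in the
  letters \<open>y z\<^sup>k\<close>. Deconcatenation makes it a Hopf algebra, whose antipode \<open>\<sigma>\<close> is
  \<open>yu \<mapsto> - y \<tau>(u)\<close> with \<open>\<tau>\<close> the anti-automorphism exchanging \<open>x\<close> and \<open>y\<close>. The operator
  \<open>yu \<mapsto> y(x + 2y)u\<close>, \<open>1 \<mapsto> y\<close>, through which \<open>F\<close> is defined, satisfies the same cocycle identity
  for deconcatenation as \<open>B\<^sub>+\<close> does for \<open>\<Delta>\<close>, so \<open>F\<close> is a morphism of Hopf algebras and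
  \<open>F \<circ> S = \<sigma> \<circ> F\<close>. Finally \<open>\<sigma>\<close> turns \<open>yu \<mapsto> y(x + 2y)u\<close> into right multiplication by \<open>2x + y\<close>,
  so \<open>F \<circ> S\<close> satisfies the recursion that defines \<open>G\<close>.
\<close>

section \<open>Linear and bilinear maps\<close>

lemma scale_mult:
  fixes p q :: "'a::monoid_add \<Rightarrow>\<^sub>0 rat"
  shows "scale c p * q = scale c (p * q)" "p * scale c q = scale c (p * q)"
proof -
  show left: "scale c p * q = scale c (p * q)" for c and p q :: "'a \<Rightarrow>\<^sub>0 rat"
    by (simp add: scale_conv_mult mult.assoc)
  have "p * Poly_Mapping.single 0 c = Poly_Mapping.single 0 c * p"
  proof (induction p rule: basis_induct)
    case (scale d p)
    have "Poly_Mapping.single 0 c * scale d p = scale d (Poly_Mapping.single 0 c * p)"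
      by (simp add: scale_conv_mult mult.assoc[symmetric] mult_single mult.commute)
    with scale show ?case by (simp add: left)
  qed (simp_all add: distrib_left distrib_right mult_single)
  then show "p * scale c q = scale c (p * q)"
    by (simp add: scale_conv_mult mult.assoc[symmetric])
qed

definition lin :: "(('a \<Rightarrow>\<^sub>0 rat) \<Rightarrow> ('b \<Rightarrow>\<^sub>0 rat)) \<Rightarrow> bool" where
  "lin \<phi> \<longleftrightarrow> (\<forall>p q. \<phi> (p + q) = \<phi> p + \<phi> q) \<and> (\<forall>c p. \<phi> (scale c p) = scale c (\<phi> p))"

lemma linI:
  "(\<And>p q. \<phi> (p + q) = \<phi> p + \<phi> q) \<Longrightarrow> (\<And>c p. \<phi> (scale c p) = scale c (\<phi> p)) \<Longrightarrow> lin \<phi>"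
  by (simp add: lin_def)

lemma linD:
  assumes "lin \<phi>"
  shows "\<phi> (p + q) = \<phi> p + \<phi> q" "\<phi> (scale c p) = scale c (\<phi> p)"
  using assms by (simp_all add: lin_def)

lemma lin_diff_eq: "lin \<phi> \<Longrightarrow> \<phi> (p - q) = \<phi> p - \<phi> q"
  by (metis add_diff_cancel_right' diff_add_cancel linD(1))

lemma lin_lin_ext: "lin \<phi> \<Longrightarrow> \<phi> (lin_ext g p) = lin_ext (\<lambda>a. \<phi> (g a)) p"
  by (induction p rule: basis_induct) (simp_all add: linD)

lemma lin_eqI: "lin \<phi> \<Longrightarrow> lin \<psi> \<Longrightarrow> (\<And>a. \<phi> (basis a) = \<psi> (basis a)) \<Longrightarrow> \<phi> p = \<psi> p"
  by (induction p rule: basis_induct) (simp_all add: linD)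

lemma lin_lin_ext_apply [simp, intro]: "lin (lin_ext g)"
  by (simp add: lin_def)

lemma lin_ext_cong: "(\<And>a. a \<in> Poly_Mapping.keys p \<Longrightarrow> g a = h a) \<Longrightarrow> lin_ext g p = lin_ext h p"
  by (simp add: lin_ext_def)

lemma lin_ext_compose: "lin_ext g (lin_ext h p) = lin_ext (\<lambda>a. lin_ext g (h a)) p"
  by (simp add: lin_lin_ext)

lemma lin_ext_basis_self [simp]: "lin_ext basis p = p"
  by (induction p rule: basis_induct) simp_all

lemma lin_ext_plus_fun: "lin_ext (\<lambda>a. g a + h a) p = lin_ext g p + lin_ext h p"
  by (simp add: lin_ext_def scale_distribs sum.distrib)

lemma lin_ext_scale_fun: "lin_ext (\<lambda>a. scale c (g a)) p = scale c (lin_ext g p)"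
  by (simp add: lin_ext_def scale_sum mult.commute)

definition bilin :: "(('a \<Rightarrow>\<^sub>0 rat) \<Rightarrow> ('b \<Rightarrow>\<^sub>0 rat) \<Rightarrow> ('c \<Rightarrow>\<^sub>0 rat)) \<Rightarrow> bool" where
  "bilin \<beta> \<longleftrightarrow> (\<forall>p. lin (\<beta> p)) \<and> (\<forall>q. lin (\<lambda>p. \<beta> p q))"

lemma bilinI: "(\<And>p. lin (\<beta> p)) \<Longrightarrow> (\<And>q. lin (\<lambda>p. \<beta> p q)) \<Longrightarrow> bilin \<beta>"
  by (simp add: bilin_def)

lemma bilinD: "bilin \<beta> \<Longrightarrow> lin (\<beta> p)" "bilin \<beta> \<Longrightarrow> lin (\<lambda>p. \<beta> p q)"
  by (simp_all add: bilin_def)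

lemma bilin_mult: "bilin ((*) :: _ \<Rightarrow> _ \<Rightarrow> 'a::monoid_add \<Rightarrow>\<^sub>0 rat)"
  by (intro bilinI linI) (simp_all add: scale_mult algebra_simps)

lemma bilin_diamond: "bilin (\<diamondop>)"
  by (intro bilinI linI) simp_all

lemma bilin_eqI:
  assumes "bilin \<beta>" "bilin \<gamma>" "\<And>a b. \<beta> (basis a) (basis b) = \<gamma> (basis a) (basis b)"
  shows "\<beta> p q = \<gamma> p q"
proof -
  have "\<beta> (basis a) q = \<gamma> (basis a) q" for a
    by (rule lin_eqI[OF bilinD(1) bilinD(1)]) (use assms in auto)
  then show ?thesis
    by (rule lin_eqI[OF bilinD(2) bilinD(2), rotated 2]) (use assms in auto)
qed

text \<open>The target product is a parameter \<open>\<beta>\<close>, so that one lemma serves the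
  library products as well as \<open>diamond\<close> and \<open>diamond2\<close>.\<close>

lemma lin_ext_hom:
  fixes g :: "'a::monoid_add \<Rightarrow> 'b \<Rightarrow>\<^sub>0 rat"
  assumes "bilin \<beta>" "\<And>a b. g (a + b) = \<beta> (g a) (g b)"
  shows "lin_ext g (p * q) = \<beta> (lin_ext g p) (lin_ext g q)"
proof (rule bilin_eqI[where \<beta> = "\<lambda>p q. lin_ext g (p * q)" and \<gamma> = "\<lambda>p q. \<beta> (lin_ext g p) (lin_ext g q)"])
  show "bilin (\<lambda>p q. lin_ext g (p * q))"
    by (intro bilinI linI) (simp_all add: scale_mult algebra_simps)
  show "bilin (\<lambda>p q. \<beta> (lin_ext g p) (lin_ext g q))"
    by (intro bilinI linI)
      (simp_all add: linD[OF bilinD(1)[OF assms(1)]] linD[OF bilinD(2)[OF assms(1)]])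
qed (simp_all add: mult_single assms)

text \<open>Polymorphic form of \<open>tensor\<close>, since tensors of words are needed besides
  tensors of forests.\<close>

definition tens :: "('a \<Rightarrow>\<^sub>0 rat) \<Rightarrow> ('b \<Rightarrow>\<^sub>0 rat) \<Rightarrow> ('a \<times> 'b \<Rightarrow>\<^sub>0 rat)" where
  "tens p q = lin_ext (\<lambda>a. lin_ext (\<lambda>b. basis (a, b)) q) p"

lemma bilin_tens: "bilin tens"
  by (intro bilinI linI)
    (simp_all add: tens_def lin_ext_plus_fun lin_ext_scale_fun)

lemma tensor_eq_tens: "tensor = tens"
  by (simp add: fun_eq_iff tensor_def tens_def)

lemma tens_basis [simp]: "tens (basis a) (basis b) = basis (a, b)"
  by (simp add: tens_def)

lemmas tens_linear =
  linD[OF bilinD(1)[OF bilin_tens]] linD[OF bilinD(2)[OF bilin_tens]]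

lemma tens_mult: "tens p q * tens r s = tens (p * r) (q * s)"
  for p r :: "'a::monoid_add \<Rightarrow>\<^sub>0 rat" and q s :: "'b::monoid_add \<Rightarrow>\<^sub>0 rat"
proof -
  have 1: "tens (basis a) (basis b) * tens r s = tens (basis a * r) (basis b * s)" for a b
    by (rule bilin_eqI[where p = r and q = s], (intro bilinI linI;
       simp add: tens_linear algebra_simps scale_mult)+)
      (simp add: mult_single)
  show ?thesis
    by (rule bilin_eqI[where p = p and q = q], (intro bilinI linI;
       simp add: tens_linear algebra_simps scale_mult)+)
      (use 1 in simp)
qed

lemma lin_ext_tens:
  assumes "bilin \<beta>"
  shows "lin_ext (\<lambda>(a, b). \<beta> (\<phi> a) (\<psi> b)) (tens p q) = \<beta> (lin_ext \<phi> p) (lin_ext \<psi> q)"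
  by (rule bilin_eqI[where p = p and q = q], (intro bilinI linI;
       simp add: tens_linear algebra_simps scale_mult linD[OF bilinD(1)[OF assms]] linD[OF bilinD(2)[OF assms]])+)
   simp


section \<open>The quasi-shuffle Hopf algebra\<close>

abbreviation var_z :: word_alg where "var_z \<equiv> var_x + var_y"

text \<open>Substituting x = z - y and using linearity in z removes x from the recursion. What
  remains is a quasi-shuffle rule, whose last term is the contraction.\<close>

lemma diamond_y_y:
  "(var_y * p) \<diamondop> (var_y * q) = var_y * (p \<diamondop> (var_y * q) + (var_y * p) \<diamondop> q - var_z * (p \<diamondop> q))"
proof -
  have "(var_x * p) \<diamondop> q = var_z * (p \<diamondop> q) - (var_y * p) \<diamondop> q"
    by (metis add_diff_cancel_right' diamond_linear_left(1) diamond_z_left distrib_right)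
  then show ?thesis
    by (simp only: diamond_rules) (simp add: algebra_simps)
qed

section \<open>The componentwise product on the tensor square\<close>

type_synonym word_alg2 = "letter list \<times> letter list \<Rightarrow>\<^sub>0 rat"

definition diamond2 :: "word_alg2 \<Rightarrow> word_alg2 \<Rightarrow> word_alg2"  (infixl \<open>\<diamondop>\<diamondop>\<close> 70) where
  "P \<diamondop>\<diamondop> Q = lin_ext (\<lambda>(a, b). lin_ext (\<lambda>(c, d). tens (diamond_word a c) (diamond_word b d)) Q) P"

lemma bilin_diamond2: "bilin (\<diamondop>\<diamondop>)"
  by (intro bilinI linI)
    (simp_all add: diamond2_def case_prod_unfold lin_ext_plus_fun lin_ext_scale_fun)

lemmas diamond2_linear =
  linD[OF bilinD(1)[OF bilin_diamond2]] linD[OF bilinD(2)[OF bilin_diamond2]]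

lemmas diamond2_diff =
  lin_diff_eq[OF bilinD(1)[OF bilin_diamond2]] lin_diff_eq[OF bilinD(2)[OF bilin_diamond2]]

lemmas tens_diff =
  lin_diff_eq[OF bilinD(1)[OF bilin_tens]] lin_diff_eq[OF bilinD(2)[OF bilin_tens]]

lemmas multilinear_simps =
  diamond2_linear diamond2_diff tens_linear tens_diff scale_mult scale_distribs algebra_simps

lemma diamond2_tens: "tens p q \<diamondop>\<diamondop> tens r s = tens (p \<diamondop> r) (q \<diamondop> s)"
proof -
  have 1: "tens (basis a) (basis b) \<diamondop>\<diamondop> tens r s = tens (basis a \<diamondop> r) (basis b \<diamondop> s)" for a b
    by (rule bilin_eqI[where p = r and q = s], (intro bilinI linI;
       simp add: multilinear_simps del: tens_basis)+)
      (simp add: diamond2_def)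
  show ?thesis
    by (rule bilin_eqI[where p = p and q = q], (intro bilinI linI;
       simp add: multilinear_simps)+)
      (use 1 in simp)
qed

lemma tens_eqI:
  assumes "bilin \<beta>" "bilin \<gamma>"
    "\<And>p q r s. \<beta> (tens p q) (tens r s) = \<gamma> (tens p q) (tens r s)"
  shows "\<beta> P Q = \<gamma> P Q"
  by (rule bilin_eqI[OF assms(1,2)]) (metis assms(3) surj_pair tens_basis)

lemma diamond2_z_left: "(tens var_z 1 * P) \<diamondop>\<diamondop> Q = tens var_z 1 * (P \<diamondop>\<diamondop> Q)"
  by (rule tens_eqI[where P = P and Q = Q], (intro bilinI linI;
       simp add: multilinear_simps)+)
    (simp add: tens_mult diamond2_tens diamond_z_left)

lemma diamond2_commute: "P \<diamondop>\<diamondop> Q = Q \<diamondop>\<diamondop> P"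
  by (rule tens_eqI[where P = P and Q = Q and \<gamma> = "\<lambda>P Q. Q \<diamondop>\<diamondop> P"], (intro bilinI linI;
       simp add: multilinear_simps)+)
    (simp add: diamond2_tens diamond_commute)

lemma diamond2_z_right: "P \<diamondop>\<diamondop> (tens var_z 1 * Q) = tens var_z 1 * (P \<diamondop>\<diamondop> Q)"
  by (metis diamond2_commute diamond2_z_left)

lemma diamond2_y_y:
  "(tens var_y 1 * P) \<diamondop>\<diamondop> (tens var_y 1 * Q) =
     tens var_y 1 * (P \<diamondop>\<diamondop> (tens var_y 1 * Q) + (tens var_y 1 * P) \<diamondop>\<diamondop> Q
       - tens var_z 1 * (P \<diamondop>\<diamondop> Q))"
  by (rule tens_eqI[where P = P and Q = Q], (intro bilinI linI;
       simp add: multilinear_simps)+)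
    (simp add: tens_mult diamond2_tens diamond_y_y tens_linear tens_diff algebra_simps)

text \<open>The other operand has 1 in its first factor, so nothing is shuffled there and y simply
  moves out.\<close>

lemma diamond2_y_right:
  "(tens var_y 1 * P) \<diamondop>\<diamondop> tens 1 q = tens var_y 1 * (P \<diamondop>\<diamondop> tens 1 q)"
  "tens 1 q \<diamondop>\<diamondop> (tens var_y 1 * P) = tens var_y 1 * (tens 1 q \<diamondop>\<diamondop> P)"
proof -
  show "(tens var_y 1 * P) \<diamondop>\<diamondop> tens 1 q = tens var_y 1 * (P \<diamondop>\<diamondop> tens 1 q)"
  proof (rule lin_eqI[where p = P])
    fix ab :: "letter list \<times> letter list"
    show "(tens var_y 1 * basis ab) \<diamondop>\<diamondop> tens 1 q = tens var_y 1 * (basis ab \<diamondop>\<diamondop> tens 1 q)"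
      by (cases ab) (simp add: tens_mult diamond2_tens diamond_one_right flip: tens_basis)
  qed (intro linI; simp add: multilinear_simps)+
  then show "tens 1 q \<diamondop>\<diamondop> (tens var_y 1 * P) = tens var_y 1 * (tens 1 q \<diamondop>\<diamondop> P)"
    by (metis diamond2_commute)
qed

text \<open>
  On \<open>\<rat> + y\<A>\<close>, with basis the words in the letters \<open>y z\<^sup>k\<close> where \<open>z = x + y\<close>, this is
  deconcatenation, and \<open>\<diamondop>\<close> is a quasi-shuffle product. The extension to \<open>\<A>\<close> is linear
  over left multiplication by \<open>z\<close>.
\<close>

fun decon_word :: "letter list \<Rightarrow> word_alg2" where
  "decon_word [] = basis ([], [])"
| "decon_word (Y # w) = basis ([], Y # w) + tens var_y 1 * decon_word w"
| "decon_word (X # w) = tens var_x 1 * decon_word w - basis ([], Y # w)"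

definition decon :: "word_alg \<Rightarrow> word_alg2" where
  "decon = lin_ext decon_word"

lemma decon_linear [simp]:
  "decon (p + q) = decon p + decon q" "decon (p - q) = decon p - decon q"
  "decon (scale c p) = scale c (decon p)" "decon (basis w) = decon_word w"
  by (simp_all add: decon_def)

lemma tens_one_basis: "tens (1 :: word_alg) (basis w) = basis ([], w)"
  by (simp add: one_conv_basis)

lemma decon_one: "decon 1 = tens 1 1"
  by (simp add: one_conv_basis)

lemma decon_x: "decon (var_x * p) = tens var_x 1 * decon p - tens 1 (var_y * p)"
  by (rule lin_eqI[where p = p], (intro linI; simp add: multilinear_simps)+)
    (simp add: tens_one_basis flip: basis_Cons)

lemma decon_y: "decon (var_y * p) = tens 1 (var_y * p) + tens var_y 1 * decon p"
  by (rule lin_eqI[where p = p], (intro linI; simp add: multilinear_simps)+)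
    (simp add: tens_one_basis flip: basis_Cons)

text \<open>The terms 1 \<otimes> yp cancel; the clause of \<open>decon_word\<close> for x is chosen
  so that they do.\<close>

lemma decon_z: "decon (var_z * p) = tens var_z 1 * decon p"
  by (simp add: distrib_right decon_x decon_y tens_linear)

text \<open>Everything is linear over left multiplication by z, so x = z - y reduces nonempty words
  to words that start with y. There \<open>diamond_y_y\<close> and \<open>diamond2_y_y\<close> have
  the same shape, and induction on the total length applies.\<close>

lemma decon_diamond: "decon (p \<diamondop> q) = decon p \<diamondop>\<diamondop> decon q"
proof -
  define A where "A p q \<longleftrightarrow> decon (p \<diamondop> q) = decon p \<diamondop>\<diamondop> decon q" for p q
  have x: "var_x * p = var_z * p - var_y * p" for p by (simp add: algebra_simps)
  have x1: "A (var_x * p) q" if "A p q" "A (var_y * p) q" for p q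
    using that unfolding A_def x
    by (simp only: decon_linear decon_z diamond_linear_left diamond2_diff diamond_z_left
        diamond2_z_left)
  have x2: "A p (var_x * q)" if "A p q" "A p (var_y * q)" for p q
    using that unfolding A_def x
    by (simp only: decon_linear decon_z diamond_linear_right diamond2_diff diamond_z_right
        diamond2_z_right)
  have yy: "A (var_y * u) (var_y * v)"
    if "A u (var_y * v)" "A (var_y * u) v" "A u v" for u v
  proof -
    let ?y = "tens var_y 1"
    have "decon ((var_y * u) \<diamondop> (var_y * v)) = tens 1 ((var_y * u) \<diamondop> (var_y * v)) +
        ?y * (decon u \<diamondop>\<diamondop> decon (var_y * v) + decon (var_y * u) \<diamondop>\<diamondop> decon v
          - tens var_z 1 * (decon u \<diamondop>\<diamondop> decon v))"
      using that unfolding A_def diamond_y_y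
      by (simp only: decon_y decon_linear decon_z)
    \<comment> \<open>The right side expands into four products. The two mixed ones supply the terms
      1 \<otimes> yv and 1 \<otimes> yu that complete \<open>diamond2_y_y\<close> to
      \<open>decon (var_y * v)\<close> and \<open>decon (var_y * u)\<close>.\<close>
    also have "\<dots> = decon (var_y * u) \<diamondop>\<diamondop> decon (var_y * v)"
      by (simp only: decon_y diamond2_linear diamond2_tens diamond2_y_right diamond2_y_y
          diamond_one_left distrib_left right_diff_distrib add_ac diff_conv_add_uminus)
    finally show ?thesis by (simp add: A_def)
  qed
  have one: "tens 1 1 \<diamondop>\<diamondop> P = P" for P
    by (rule lin_eqI[where p = P], (intro linI; simp add: multilinear_simps)+)
      (metis diamond2_tens diamond_one_left surj_pair tens_basis)
  have one1: "A 1 q" for q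
    by (simp add: A_def one diamond_one_left decon_one)
  have one2: "A p 1" for p
    using one1[of p] by (simp add: A_def diamond_commute[of p] diamond2_commute[of "decon p"])
  have "A (basis u) (basis v)" for u v
  proof (induction "length u + length v" arbitrary: u v rule: less_induct)
    case less
    show ?case
    proof (cases "u = [] \<or> v = []")
      case True
      then show ?thesis using one1 one2 by (auto simp: one_conv_basis)
    next
      case False
      then obtain a u' b v' where e: "u = a # u'" "v = b # v'"
        by (metis neq_Nil_conv)
      have ih: "A (basis u1) (basis v1)" if "length u1 + length v1 < length u' + length v' + 2" for u1 v1
        using that less.hyps e by simp
      have YY: "A (basis (Y # u')) (basis (Y # v'))"
        using yy[of "basis u'" "basis v'"] ih[of u' "Y # v'"] ih[of "Y # u'" v'] ih[of u' v']
        by (simp only: basis_Cons) simp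
      have aY: "A (basis (a # u')) (basis (Y # v'))"
      proof (cases a)
        case X
        have "A (basis u') (basis (Y # v'))" by (rule ih) simp
        then show ?thesis using YY x1 X by (metis basis_Cons)
      qed (use YY in simp)
      show ?thesis
      proof (cases b)
        case X
        have "A (basis (a # u')) (basis v')" by (rule ih) simp
        then show ?thesis using aY x2 X e by (metis basis_Cons)
      qed (use aY e in simp)
    qed
  qed
  then have *: "decon (basis u \<diamondop> basis v) = decon (basis u) \<diamondop>\<diamondop> decon (basis v)" for u v
    by (simp only: A_def)
  show ?thesis
    by (rule bilin_eqI[where p = p and q = q], (intro bilinI linI;
       simp only: decon_linear diamond_linear_left diamond_linear_right diamond2_linear)+)
      (rule *)
qed

section \<open>The anti-automorphism \<tau> (\<open>dual\<close>) and the convolution inverse of the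
  identity\<close>

definition dual_word :: "letter list \<Rightarrow> letter list" where
  "dual_word w = rev (map (\<lambda>a. case a of X \<Rightarrow> Y | Y \<Rightarrow> X) w)"

definition dual :: "word_alg \<Rightarrow> word_alg" where
  "dual = lin_ext (\<lambda>w. basis (dual_word w))"

lemma dual_word_simps [simp]:
  "dual_word [] = []" "dual_word (X # w) = dual_word w @ [Y]" "dual_word (Y # w) = dual_word w @ [X]"
  "dual_word (w @ [X]) = Y # dual_word w" "dual_word (w @ [Y]) = X # dual_word w"
  by (simp_all add: dual_word_def)

text \<open>The antipode of the quasi-shuffle Hopf algebra; only the values on \<open>\<rat> + y\<A>\<close> matter.\<close>

fun sigma_word :: "letter list \<Rightarrow> word_alg" where
  "sigma_word [] = 1"
| "sigma_word (a # w) = - (var_y * basis (dual_word w))"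

definition sigma :: "word_alg \<Rightarrow> word_alg" where
  "sigma = lin_ext sigma_word"

definition sigma_term :: "letter list \<times> letter list \<Rightarrow> word_alg" where
  "sigma_term = (\<lambda>(a, b). basis a \<diamondop> sigma_word b)"

text \<open>Dropping the first letter unseen is harmless: right factors in \<open>decon_word\<close>
  are empty or start with y.\<close>

fun tail_dual :: "letter list \<Rightarrow> word_alg" where
  "tail_dual [] = 0"
| "tail_dual (a # w) = basis (dual_word w)"

definition tail_term :: "letter list \<times> letter list \<Rightarrow> word_alg" where
  "tail_term = (\<lambda>(a, b). (var_x * basis a) \<diamondop> tail_dual b)"

text \<open>
  \<open>conv_sigma\<close> is the convolution of the identity and \<open>sigma\<close>. With \<open>decon w = \<Sum> a \<otimes> b\<close>,
  \<open>conv_tail w\<close> is the sum of \<open>xa \<diamondop> dual v\<close> over the terms with \<open>b = yv\<close>. An induction that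
  appends letters on the right shows \<open>dual = conv_sigma + conv_tail\<close>, which is exactly what makes
  \<open>conv_sigma\<close> vanish on \<open>y\<A>\<close>.
\<close>

definition conv_sigma :: "word_alg \<Rightarrow> word_alg" where
  "conv_sigma p = lin_ext sigma_term (decon p)"

definition conv_tail :: "word_alg \<Rightarrow> word_alg" where
  "conv_tail p = lin_ext tail_term (decon p)"

text \<open>Effect on one term of a deconcatenation when the word gets a new last letter. If the
  right factor is empty, a cut before the new letter appears as well; its sign in
  \<open>snoc_x\<close> is that of the clause of \<open>decon_word\<close> for x.\<close>

fun snoc_y :: "letter list \<times> letter list \<Rightarrow> word_alg2" where
  "snoc_y (a, []) = basis (a @ [Y], []) + basis (a, [Y])"
| "snoc_y (a, c # b) = basis (a, c # b @ [Y])"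

fun snoc_x :: "letter list \<times> letter list \<Rightarrow> word_alg2" where
  "snoc_x (a, []) = basis (a @ [X], []) - basis (a, [Y])"
| "snoc_x (a, c # b) = basis (a, c # b @ [X])"

lemma tens_left_basis: "tens (basis u) (1 :: word_alg) * basis (a, b) = basis (u @ a, b)"
  by (simp add: one_conv_basis mult_single plus_list_def)

lemma lin_ext_snoc_left:
  "lin_ext snoc_y (tens (basis u) 1 * P) = tens (basis u) 1 * lin_ext snoc_y P"
  "lin_ext snoc_x (tens (basis u) 1 * P) = tens (basis u) 1 * lin_ext snoc_x P"
proof -
  have *: "snoc_y (u @ a, b) = tens (basis u) 1 * snoc_y (a, b)"
    "snoc_x (u @ a, b) = tens (basis u) 1 * snoc_x (a, b)" for a b
    by (cases b; simp add: distrib_left right_diff_distrib tens_left_basis)+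
  show "lin_ext snoc_y (tens (basis u) 1 * P) = tens (basis u) 1 * lin_ext snoc_y P"
    by (rule lin_eqI[where p = P], (intro linI; simp add: scale_mult algebra_simps)+)
      (use * in \<open>force simp: tens_left_basis\<close>)
  show "lin_ext snoc_x (tens (basis u) 1 * P) = tens (basis u) 1 * lin_ext snoc_x P"
    by (rule lin_eqI[where p = P], (intro linI; simp add: scale_mult algebra_simps)+)
      (use * in \<open>force simp: tens_left_basis\<close>)
qed

text \<open>\<open>decon_word\<close> recurses from the left, whereas \<open>dual\<close> turns an
  appended letter into a first letter; this supplies the recursion from the right.\<close>

lemma decon_word_snoc:
  "decon_word (w @ [Y]) = lin_ext snoc_y (decon_word w)"
  "decon_word (w @ [X]) = lin_ext snoc_x (decon_word w)"
  by (induction w rule: decon_word.induct)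
    (simp_all add: var_x_def var_y_def lin_ext_snoc_left tens_left_basis)

lemma diamond_zero [simp]: "p \<diamondop> 0 = 0" "0 \<diamondop> p = 0"
  using diamond_linear_right(2)[of p 0 0] diamond_linear_left(2)[of 0 0 p] by simp_all

lemma diamond_uminus [simp]: "p \<diamondop> (- q) = - (p \<diamondop> q)"
  using diamond_linear_right(2)[of p 0 q] by simp

text \<open>If the right factor is nonempty, the rule for y against y yields a second summand, in
  which x is put before the left factor; \<open>tail_term\<close> collects it.\<close>

lemma sigma_term_y:
  "lin_ext sigma_term (tens var_y 1 * P) = var_y * (lin_ext sigma_term P + lin_ext tail_term P)"
proof (rule lin_eqI[where p = P])
  fix ab :: "letter list \<times> letter list"
  obtain a b where ab: "ab = (a, b)" by force
  have "tens var_y 1 * basis (a, b) = basis (Y # a, b)"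
    by (simp add: var_y_def tens_left_basis)
  moreover have "sigma_term (Y # a, b) = var_y * (sigma_term (a, b) + tail_term (a, b))"
    by (cases b)
      (simp_all add: sigma_term_def tail_term_def diamond_one_right diamond_rules basis_Cons
        algebra_simps del: diamond_basis)
  ultimately show "lin_ext sigma_term (tens var_y 1 * basis ab) =
      var_y * (lin_ext sigma_term (basis ab) + lin_ext tail_term (basis ab))"
    by (simp add: ab)
qed (intro linI; simp add: scale_mult algebra_simps scale_distribs)+

lemma sigma_term_z: "lin_ext sigma_term (tens var_z 1 * P) = var_z * lin_ext sigma_term P"
proof (rule lin_eqI[where p = P])
  fix ab :: "letter list \<times> letter list"
  obtain a b where ab: "ab = (a, b)" by force
  have "tens var_z 1 * basis (a, b) = basis (X # a, b) + basis (Y # a, b)"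
    by (simp add: var_y_def var_x_def tens_left_basis tens_linear distrib_right)
  moreover have "sigma_term (X # a, b) + sigma_term (Y # a, b) = var_z * sigma_term (a, b)"
    by (simp add: sigma_term_def basis_Cons del: diamond_basis)
      (metis diamond_linear_left(1) diamond_z_left distrib_right)
  ultimately show "lin_ext sigma_term (tens var_z 1 * basis ab) = var_z * lin_ext sigma_term (basis ab)"
    by (simp add: ab)
qed (intro linI; simp add: scale_mult algebra_simps scale_distribs)+

lemma conv_sigma_z: "conv_sigma (var_z * p) = var_z * conv_sigma p"
  by (simp only: conv_sigma_def conv_tail_def decon_z sigma_term_z)

lemma conv_sigma_y: "conv_sigma (var_y * p) = var_y * (conv_sigma p + conv_tail p - dual p)"
proof -
  have "lin_ext sigma_term (tens 1 (var_y * p)) = - (var_y * dual p)"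
    by (rule lin_eqI[where p = p], (intro linI;
       simp add: multilinear_simps dual_def)+)
      (simp add: tens_one_basis sigma_term_def dual_def diamond_one_left
        flip: basis_Cons one_conv_basis del: diamond_basis)
  then show ?thesis
    by (simp add: conv_sigma_def conv_tail_def decon_y sigma_term_y algebra_simps)
qed

lemma conv_tail_snoc:
  "conv_tail (basis (w @ [Y])) = var_x * (conv_sigma (basis w) + conv_tail (basis w))"
  "conv_tail (basis (w @ [X])) = var_z * conv_tail (basis w) - conv_tail (basis (w @ [Y]))"
proof -
  \<comment> \<open>The rule for x against x, rewritten by moving z from p to q, so that products of
    the form of \<open>sigma_term\<close> appear.\<close>
  have x: "(var_x * p) \<diamondop> (var_x * q) = var_x * ((var_x * p) \<diamondop> q - p \<diamondop> (var_y * q))" for p q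
  proof -
    have "p \<diamondop> (var_x * q) + p \<diamondop> (var_y * q) = (var_x * p) \<diamondop> q + (var_y * p) \<diamondop> q"
      by (metis diamond_linear_left(1) diamond_linear_right(1) diamond_z_left diamond_z_right distrib_right)
    then have "p \<diamondop> (var_x * q) - (var_y * p) \<diamondop> q = (var_x * p) \<diamondop> q - p \<diamondop> (var_y * q)"
      by (simp add: algebra_simps)
    then show ?thesis
      by (simp only: diamond_rules flip: right_diff_distrib)
  qed
  have 1: "lin_ext tail_term (snoc_y (a, b)) = var_x * (sigma_term (a, b) + tail_term (a, b))" for a b
    by (cases b)
      (simp_all add: sigma_term_def tail_term_def diamond_one_right basis_Cons x
        one_conv_basis[symmetric] algebra_simps del: diamond_basis)
  have 2: "lin_ext tail_term (snoc_x (a, b)) = var_z * tail_term (a, b) - lin_ext tail_term (snoc_y (a, b))" for a b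
  proof (cases b)
    case (Cons c v)
    have "(var_x * basis a) \<diamondop> (var_y * p) + (var_x * basis a) \<diamondop> (var_x * p) = var_z * ((var_x * basis a) \<diamondop> p)" for p
      by (metis add.commute diamond_linear_right(1) diamond_z_right distrib_right)
    then show ?thesis
      by (simp add: Cons tail_term_def basis_Cons eq_diff_eq)
  qed (simp add: tail_term_def)
  show "conv_tail (basis (w @ [Y])) = var_x * (conv_sigma (basis w) + conv_tail (basis w))"
    unfolding conv_sigma_def conv_tail_def decon_linear decon_word_snoc lin_ext_compose
    by (rule lin_eqI[where p = "decon_word w"], (intro linI; simp add: scale_mult algebra_simps scale_distribs)+)
      (use 1 in force)
  show "conv_tail (basis (w @ [X])) = var_z * conv_tail (basis w) - conv_tail (basis (w @ [Y]))"
    unfolding conv_sigma_def conv_tail_def decon_linear decon_word_snoc lin_ext_compose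
    by (rule lin_eqI[where p = "decon_word w"], (intro linI; simp add: scale_mult algebra_simps scale_distribs)+)
      (use 2 in force)
qed

lemma dual_eq_conv: "basis (dual_word w) = conv_sigma (basis w) + conv_tail (basis w)"
proof (induction w rule: length_induct)
  case (1 w)
  \<comment> \<open>Closed form of \<open>conv_sigma\<close>, which is recursive only from the left;
    with it the effect of a new last letter can be read off.\<close>
  define \<kappa> :: "letter list \<Rightarrow> word_alg" where
    "\<kappa> v = (if Y \<in> set v then 0 else var_z ^ length v)" for v
  have one: "conv_sigma 1 = 1" "conv_tail 1 = 0"
    by (simp_all add: one_conv_basis conv_sigma_def conv_tail_def sigma_term_def tail_term_def)
  have dual: "dual (basis v) = conv_sigma (basis v) + conv_tail (basis v)" if "length v < length w" for v
    using that 1 by (simp add: dual_def)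
  \<comment> \<open>The bound includes w itself: by \<open>conv_sigma_y\<close>, vanishing at yv
    needs the induction hypothesis only at the shorter word v.\<close>
  have \<kappa>: "conv_sigma (basis v) = \<kappa> v" if "length v \<le> length w" for v
    using that
  proof (induction v)
    case Nil
    then show ?case by (simp add: \<kappa>_def one_conv_basis[symmetric] one)
  next
    case (Cons a v)
    have y: "conv_sigma (var_y * basis v) = 0"
      using Cons.prems dual[of v] by (simp add: conv_sigma_y)
    have "conv_sigma (var_x * basis v) + conv_sigma (var_y * basis v) = var_z * conv_sigma (basis v)"
      by (metis conv_sigma_def conv_sigma_z decon_linear(1) distrib_right lin_ext_add)
    with y Cons show ?case
      by (cases a) (auto simp: basis_Cons \<kappa>_def)
  qed
  show ?case
  proof (cases w rule: rev_cases)
    case Nil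
    then show ?thesis by (simp add: one_conv_basis[symmetric] one)
  next
    case (snoc v a)
    have v: "basis (dual_word v) = conv_sigma (basis v) + conv_tail (basis v)"
      using snoc 1 by simp
    have Y: "conv_tail (basis (v @ [Y])) = var_x * basis (dual_word v)"
      by (simp add: conv_tail_snoc v)
    have *: "\<kappa> (v @ [Y]) = 0" "\<kappa> (v @ [X]) = var_z * \<kappa> v"
      by (simp_all add: \<kappa>_def)
    have \<kappa>v: "conv_sigma (basis v) = \<kappa> v" "conv_sigma (basis (v @ [a])) = \<kappa> (v @ [a])"
      by (simp_all add: \<kappa> snoc)
    \<comment> \<open>The case of a last letter x: z times the hypothesis for v, minus x times the
      dual of v, leaves y times that dual.\<close>
    have "var_z * \<kappa> v + (var_z * conv_tail (basis v) - var_x * basis (dual_word v)) = var_y * basis (dual_word v)"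
      by (simp add: v \<kappa>v algebra_simps)
    then show ?thesis
      unfolding snoc by (cases a) (use \<kappa>v * Y in \<open>simp_all add: basis_Cons conv_tail_snoc(2)\<close>)
  qed
qed

text \<open>Together with \<open>conv_sigma_one\<close>: on \<rat> + yA, \<open>sigma\<close> is a
  right convolution inverse of the identity.\<close>

lemma conv_sigma_y_eq_0: "conv_sigma (var_y * p) = 0"
proof -
  have "dual p = conv_sigma p + conv_tail p"
    by (rule lin_eqI[where p = p], (intro linI;
       simp add: dual_def conv_sigma_def conv_tail_def multilinear_simps)+)
      (simp add: dual_def dual_eq_conv)
  then show ?thesis by (simp add: conv_sigma_y)
qed

lemma conv_sigma_one: "conv_sigma 1 = 1"
  by (simp add: one_conv_basis conv_sigma_def conv_tail_def sigma_term_def)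


section \<open>\<open>F\<close> as a morphism of coalgebras\<close>

text \<open>The operator on words that corresponds to \<open>B\<^sub>+\<close> under \<open>F\<close>.\<close>

fun lam_word :: "letter list \<Rightarrow> word_alg" where
  "lam_word [] = var_y"
| "lam_word (a # w) = var_y * ((var_x + 2 * var_y) * basis w)"

definition lam :: "word_alg \<Rightarrow> word_alg" where
  "lam = lin_ext lam_word"

lemma lam_one: "lam 1 = var_y"
  by (simp add: lam_def one_conv_basis)

lemma lam_y: "lam (var_y * p) = var_y * ((var_x + 2 * var_y) * p)"
  by (rule lin_eqI[where p = p], (intro linI;
       simp add: multilinear_simps lam_def)+)
    (simp add: lam_def flip: basis_Cons)

definition lam_left :: "word_alg2 \<Rightarrow> word_alg2" where
  "lam_left = lin_ext (\<lambda>(a, b). tens (lam_word a) (basis b))"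

lemma lam_left_tens: "lam_left (tens p q) = tens (lam p) q"
  using lin_ext_tens[OF bilin_tens, of lam_word basis p q]
  by (simp add: lam_left_def lam_def)

lemma lam_left_y: "lam_left (tens var_y 1 * P) = tens (var_y * (var_x + 2 * var_y)) 1 * P"
proof (rule lin_eqI[where p = P])
  show "lam_left (tens var_y 1 * basis ab) = tens (var_y * (var_x + 2 * var_y)) 1 * basis ab"
    for ab
    by (cases ab) (simp add: tens_mult lam_left_tens lam_y mult.assoc flip: tens_basis)
qed (intro linI; simp add: multilinear_simps lam_left_def)+

lemma decon_lam_one: "decon (lam 1) = tens 1 (lam 1) + lam_left (decon 1)"
  using decon_y[of 1] by (simp add: lam_one decon_one lam_left_tens tens_mult)

lemma lam_left_add: "lam_left (P + Q) = lam_left P + lam_left Q"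
  by (simp add: lam_left_def)

text \<open>The cocycle identity. Since x + 2y = z + y, deconcatenating (x + 2y)p produces one extra
  term 1 \<otimes> yp; preceded by y it becomes y \<otimes> yp, the image of 1 \<otimes> yp under
  \<open>lam_left\<close>.\<close>

lemma decon_lam_y:
  "decon (lam (var_y * p)) = tens 1 (lam (var_y * p)) + lam_left (decon (var_y * p))"
proof -
  have "(var_x + 2 * var_y) * p = var_z * p + var_y * p"
    by (simp add: mult_2 distrib_right add.assoc)
  then have "decon ((var_x + 2 * var_y) * p) = tens (var_x + 2 * var_y) 1 * decon p + tens 1 (var_y * p)"
    by (simp only: decon_linear decon_z decon_y)
      (simp add: mult_2 distrib_right tens_linear algebra_simps)
  then have "tens var_y 1 * decon ((var_x + 2 * var_y) * p) =
      tens (var_y * (var_x + 2 * var_y)) 1 * decon p + tens var_y (var_y * p)"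
    by (simp only: distrib_left tens_mult mult.assoc[symmetric] mult_1_left mult_1_right)
  then show ?thesis
    by (simp add: lam_y decon_y[of "(var_x + 2 * var_y) * p"])
      (simp add: decon_y lam_left_add lam_left_tens lam_left_y lam_one)
qed

lemma sigma_y: "sigma (var_y * p) = - (var_y * dual p)"
  by (rule lin_eqI[where p = p], (intro linI;
       simp add: multilinear_simps sigma_def dual_def)+)
    (simp add: sigma_def dual_def flip: basis_Cons)

text \<open>\<open>dual\<close> reverses products and exchanges x and y, so the left factor x + 2y
  turns into the right factor 2x + y of the recursion for G.\<close>

lemma sigma_lam_y: "sigma (lam (var_y * p)) = sigma (var_y * p) * (2 * var_x + var_y)"
proof -
  have xy: "dual (var_x * p) = dual p * var_y" "dual (var_y * p) = dual p * var_x" for p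
    by (rule lin_eqI[where p = p], (intro linI;
       simp add: multilinear_simps dual_def)+,
       simp add: dual_def var_x_def var_y_def mult_basis_word)+
  have "dual (p + q) = dual p + dual q" for p q
    by (simp add: dual_def)
  then have "dual ((var_x + 2 * var_y) * p) = dual p * (2 * var_x + var_y)"
    by (simp add: mult_2 distrib_right distrib_left xy add_ac)
  then show ?thesis
    by (simp add: lam_y sigma_y mult.assoc)
qed

lemma sigma_lam_one: "sigma (lam 1) = - var_y"
proof -
  have "dual 1 = 1" by (simp add: dual_def one_conv_basis)
  then show ?thesis using sigma_y[of 1] by (simp add: lam_one)
qed

section \<open>Compatibility of F with grafting and coproducts\<close>

lemma F_forest_add_mset: "F_forest (add_mset t f) = F_tree t \<diamondop> F_forest f"
  by (simp add: F_forest_def)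

lemma F_tree_y: "\<exists>p. F_tree t = var_y * p"
proof (cases t)
  case (B_plus f)
  have "f = {#} \<Longrightarrow> F_tree t = var_y * 1"
    by (simp add: B_plus)
  then show ?thesis
    by (cases "f = {#}") (auto simp: B_plus L_def simp del: mult_1_right)
qed

text \<open>By \<open>diamond_y_y\<close> a product of elements of yA is again in yA. Hence
  \<open>Ly_inv\<close> is only applied where it inverts \<open>L var_y\<close>, and the two cases
  match those of \<open>lam\<close>.\<close>

lemma F_forest_cases:
  obtains "f = {#}" "F_forest f = 1" | p where "f \<noteq> {#}" "F_forest f = var_y * p"
proof -
  have "\<exists>p. F_forest f = var_y * p" if "f \<noteq> {#}"
    using that
  proof (induction f)
    case (add t f)
    obtain p where p: "F_tree t = var_y * p" using F_tree_y by blast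
    show ?case
    proof (cases "f = {#}")
      case True
      then show ?thesis using p by (auto simp: F_forest_def diamond_one_right)
    next
      case False
      then show ?thesis using add.IH p by (auto simp: F_forest_add_mset diamond_y_y)
    qed
  qed simp
  then show ?thesis using that by (cases "f = {#}") (auto simp: F_forest_def)
qed

lemma F_tree_eq_lam: "F_tree (B_plus f) = lam (F_forest f)"
proof (cases f rule: F_forest_cases)
  case (2 p)
  moreover have "Ly_inv (var_y * p) = p" for p
    using Ly_inv_Ly[of p] by (simp add: L_def)
  ultimately show ?thesis
    by (simp add: lam_y L_def flip: F_forest_def)
qed (simp add: lam_one F_forest_def)

lemma decon_lam_F_forest:
  "decon (lam (F_forest f)) = tens 1 (lam (F_forest f)) + lam_left (decon (F_forest f))"
  by (cases f rule: F_forest_cases) (simp_all add: decon_lam_one decon_lam_y)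

lemma basis_empty: "basis {#} = (1 :: hopf)" "basis ({#}, {#}) = (1 :: hopf2)"
  by (simp_all flip: zero_prod_def)

lemma coproduct_forest_simps [simp]:
  "coproduct_forest {#} = 1"
  "coproduct_forest (add_mset t f) = coproduct_tree t * coproduct_forest f"
  by (simp_all add: coproduct_forest_def)

definition graft_left :: "hopf2 \<Rightarrow> hopf2" where
  "graft_left = lin_ext (\<lambda>(a, b). basis ({#B_plus a#}, b))"

lemma tensor_map_B_plus: "tensor_map B_plus_lin id = graft_left"
  by (simp add: fun_eq_iff tensor_map_def B_plus_lin_def tensor_eq_tens graft_left_def)

lemma coproduct_tree_B_plus:
  "coproduct_tree (B_plus f) = basis ({#}, {#B_plus f#}) + graft_left (coproduct_forest f)"
  by (simp add: coproduct_forest_def tensor_map_B_plus)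

declare coproduct_tree.simps [simp del]

definition FF :: "hopf2 \<Rightarrow> word_alg2" where
  "FF = lin_ext (\<lambda>(a, b). tens (F_forest a) (F_forest b))"

lemma FF_mult: "FF (P * Q) = FF P \<diamondop>\<diamondop> FF Q"
  unfolding FF_def
  by (rule lin_ext_hom[OF bilin_diamond2])
    (auto simp: F_forest_rules(4) diamond2_tens)

lemma FF_one: "FF 1 = tens 1 1"
  by (simp add: FF_def zero_prod_def F_forest_rules(1))

lemma FF_graft_left: "FF (graft_left P) = lam_left (FF P)"
  unfolding FF_def lam_left_def graft_left_def lin_ext_compose
  by (rule lin_ext_cong)
    (auto simp: F_forest_def[of "{#_#}"] diamond_one_right F_tree_eq_lam lam_left_tens
      simp flip: lam_left_def simp del: F_tree.simps)

text \<open>Both sides are multiplicative, and on trees the cocycle identity for \<open>lam\<close>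
  mirrors the recursion of the coproduct; induction on trees finishes.\<close>

lemma decon_F_forest: "decon (F_forest f) = FF (coproduct_forest f)"
proof -
  have forest: "decon (F_forest f) = FF (coproduct_forest f)"
    if "\<And>t. t \<in># f \<Longrightarrow> decon (F_tree t) = FF (coproduct_tree t)" for f
    using that
    by (induction f)
      (simp_all add: F_forest_rules(1) FF_one decon_one F_forest_add_mset decon_diamond FF_mult)
  have "decon (F_tree t) = FF (coproduct_tree t)" for t
  proof (induction t)
    case (B_plus f)
    have "FF (coproduct_tree (B_plus f)) = tens 1 (F_tree (B_plus f)) + lam_left (FF (coproduct_forest f))"
      unfolding coproduct_tree_B_plus FF_graft_left[symmetric]
      by (simp add: FF_def F_forest_def diamond_one_right del: F_tree.simps)
    also have "FF (coproduct_forest f) = decon (F_forest f)"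
      using B_plus.IH forest by simp
    finally show ?case
      by (simp only: F_tree_eq_lam decon_lam_F_forest)
  qed
  with forest show ?thesis by blast
qed

text \<open>The convolution identity for \<open>sigma\<close>, pulled back along F:
  \<open>sigma\<close> after F is a right convolution inverse of F.\<close>

lemma F_conv_sigma:
  "lin_ext (\<lambda>(a, b). F_forest a \<diamondop> sigma (F_forest b)) (coproduct_forest f) = (if f = {#} then 1 else 0)"
proof -
  have "conv_sigma (F_forest f) = (if f = {#} then 1 else 0)"
    by (cases f rule: F_forest_cases) (auto simp: conv_sigma_one conv_sigma_y_eq_0)
  moreover have "lin_ext sigma_term (tens p q) = p \<diamondop> sigma q" for p q
    using lin_ext_tens[OF bilin_diamond, of basis sigma_word p q]
    by (simp add: sigma_term_def sigma_def)
  ultimately show ?thesis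
    by (simp add: conv_sigma_def conv_tail_def decon_F_forest FF_def lin_ext_compose case_prod_unfold)
qed


section \<open>The antipode of the Connes--Kreimer algebra\<close>

text \<open>
  The value at a tree \<open>t\<close> is \<open>(id \<otimes> S) (\<Delta> t)\<close>. Recursion on this rather than on \<open>S\<close> is
  structural: with \<open>t = B\<^sub>+ f\<close> one has \<open>(id \<otimes> S) (\<Delta> t) = \<one> \<otimes> S t + (B\<^sub>+ \<otimes> id) ((id \<otimes> S) (\<Delta> f))\<close>,
  and multiplying the two factors must give \<open>0\<close>, which determines \<open>S t\<close>.
\<close>

primrec id_S_tree :: "tree \<Rightarrow> hopf2" where
  "id_S_tree (B_plus f) =
     tens 1 (- mult_map (graft_left (\<Prod>\<^sub># (image_mset id_S_tree f)))) +
     graft_left (\<Prod>\<^sub># (image_mset id_S_tree f))"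

definition id_S_forest :: "forest \<Rightarrow> hopf2" where
  "id_S_forest f = (\<Prod>t\<in>#f. id_S_tree t)"

fun S_tree :: "tree \<Rightarrow> hopf" where
  "S_tree (B_plus f) = - mult_map (graft_left (id_S_forest f))"

definition S_forest :: "forest \<Rightarrow> hopf" where
  "S_forest f = (\<Prod>t\<in>#f. S_tree t)"

lemma S_forest_simps [simp]:
  "S_forest {#} = 1" "S_forest (add_mset t f) = S_tree t * S_forest f"
  "S_forest (f + g) = S_forest f * S_forest g"
  by (simp_all add: S_forest_def)

lemma id_S_forest_simps [simp]:
  "id_S_forest {#} = 1" "id_S_forest (add_mset t f) = id_S_tree t * id_S_forest f"
  "id_S_forest (f + g) = id_S_forest f * id_S_forest g"
  by (simp_all add: id_S_forest_def)

lemma id_S_tree_B_plus: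
  "id_S_tree (B_plus f) = tens 1 (S_tree (B_plus f)) + graft_left (id_S_forest f)"
  by (simp add: id_S_forest_def)

declare id_S_tree.simps [simp del] S_tree.simps [simp del]

lemma tens_one_left_basis: "tens (1 :: hopf) (basis f) = basis ({#}, f :: forest)"
  using tens_basis[of "{#} :: forest" f] by (simp only: basis_empty)

lemma tens_one_one: "tens 1 1 = (1 :: hopf2)"
  using tens_one_left_basis[of "{#}"] by (simp only: basis_empty)

lemma graft_left_linear [simp]:
  "graft_left (P + Q) = graft_left P + graft_left Q" "graft_left (scale c P) = scale c (graft_left P)"
  "graft_left (basis (a, b)) = basis ({#B_plus a#}, b)"
  by (simp_all add: graft_left_def)

lemma graft_left_tens: "graft_left (tens p q) = tens (B_plus_lin p) q"
  using lin_ext_tens[OF bilin_tens, of "\<lambda>f. basis {#B_plus f#}" basis p q]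
  by (simp add: graft_left_def B_plus_lin_def)

lemma graft_left_mult_right: "graft_left (P * basis ({#}, g)) = graft_left P * basis ({#}, g)"
  by (rule lin_eqI[where p = P], (intro linI; simp add: scale_mult algebra_simps)+)
    (auto simp: mult_single)

lemma mult_map_linear [simp]:
  "mult_map (P + Q) = mult_map P + mult_map Q" "mult_map (scale c P) = scale c (mult_map P)"
  "mult_map (basis (a, b)) = basis (a + b)"
  by (simp_all add: mult_map_def)

lemma mult_map_tens: "mult_map (tens p q) = p * q"
  using lin_ext_tens[OF bilin_mult, of basis basis p q]
  by (simp add: mult_map_def mult_single)

lemma mult_map_mult: "mult_map (P * Q) = mult_map P * mult_map Q"
  unfolding mult_map_def
  by (rule lin_ext_hom[OF bilin_mult]) (auto simp: mult_single ac_simps)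

lemma mult_map_one: "mult_map 1 = 1"
  using mult_map_linear(3)[of "{#}" "{#}"] by (simp only: basis_empty add_0)

text \<open>Justifies the structural recursion: id \<otimes> S is multiplicative and commutes with
  grafting on the left factor, so it satisfies the same equations.\<close>

lemma lin_ext_id_S:
  "lin_ext (\<lambda>(a, b). tens (basis a) (S_forest b)) (coproduct_forest f) = id_S_forest f"
proof -
  define \<Phi> :: "hopf2 \<Rightarrow> hopf2" where "\<Phi> = lin_ext (\<lambda>(a, b). tens (basis a) (S_forest b))"
  have mult: "\<Phi> (P * Q) = \<Phi> P * \<Phi> Q" for P Q
    unfolding \<Phi>_def by (rule lin_ext_hom[OF bilin_mult]) (auto simp: tens_mult mult_single)
  have graft: "\<Phi> (graft_left P) = graft_left (\<Phi> P)" for P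
    by (rule lin_eqI[where p = P], (intro linI; simp add: \<Phi>_def)+)
      (auto simp: \<Phi>_def graft_left_tens B_plus_lin_def)
  have one: "\<Phi> 1 = 1"
    by (simp add: \<Phi>_def zero_prod_def basis_empty tens_one_one)
  have forest: "\<Phi> (coproduct_forest f) = id_S_forest f"
    if "\<And>t. t \<in># f \<Longrightarrow> \<Phi> (coproduct_tree t) = id_S_tree t" for f
    using that by (induction f) (simp_all add: mult one)
  have "\<Phi> (coproduct_tree t) = id_S_tree t" for t
  proof (induction t)
    case (B_plus f)
    have "\<Phi> (basis ({#}, {#B_plus f#})) = tens 1 (S_tree (B_plus f))"
      by (simp add: \<Phi>_def basis_empty)
    moreover have "\<Phi> (P + Q) = \<Phi> P + \<Phi> Q" for P Q
      by (simp add: \<Phi>_def)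
    moreover have "\<Phi> (coproduct_forest f) = id_S_forest f"
      using B_plus.IH forest by blast
    ultimately show ?case
      by (simp only: coproduct_tree_B_plus id_S_tree_B_plus graft)
  qed
  with forest show ?thesis by (simp add: \<Phi>_def)
qed

lemma mult_map_id_S: "mult_map (id_S_forest f) = (if f = {#} then 1 else 0)"
proof -
  have "mult_map (id_S_tree t) = 0" for t
    by (cases t) (simp add: id_S_tree_B_plus mult_map_tens S_tree.simps)
  then show ?thesis by (cases f) (simp_all add: mult_map_mult mult_map_one)
qed

text \<open>
  In the proof, with \<open>\<Delta>\<^sub>2 = (\<Delta> \<otimes> id) \<Delta>\<close>, the map \<open>U\<close> sends \<open>f\<close> to the image of \<open>\<Delta>\<^sub>2 f\<close> under
  \<open>a \<otimes> b \<otimes> c \<mapsto> a \<otimes> S b \<cdot> c\<close>. By coassociativity this should be \<open>f \<otimes> \<one>\<close>, which is shown directly.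
\<close>

lemma mult_map_S_id:
  "lin_ext (\<lambda>(a, b). S_forest a * basis b) (coproduct_forest f) = (if f = {#} then 1 else 0)"
proof -
  define \<Phi> where "\<Phi> = lin_ext (\<lambda>(a, b). S_forest a * basis b)"
  define U where "U = lin_ext (\<lambda>(a, b). id_S_forest a * basis ({#}, b))"
  have \<Phi>_add: "\<Phi> (P + Q) = \<Phi> P + \<Phi> Q" and U_add: "U (P + Q) = U P + U Q" for P Q
    by (simp_all add: \<Phi>_def U_def)
  have \<Phi>_mult: "\<Phi> (P * Q) = \<Phi> P * \<Phi> Q" for P Q
  proof -
    have "basis (a + b) = basis a * basis b" for a b :: forest
      by (simp add: mult_single)
    then show ?thesis
      unfolding \<Phi>_def by (intro lin_ext_hom[OF bilin_mult]) (auto simp: ac_simps)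
  qed
  have U_mult: "U (P * Q) = U P * U Q" for P Q
  proof -
    have "basis ({#} :: forest, a + b) = basis ({#}, a) * basis ({#}, b)" for a b :: forest
      by (simp add: mult_single)
    then show ?thesis
      unfolding U_def by (intro lin_ext_hom[OF bilin_mult]) (auto simp: ac_simps)
  qed
  have \<Phi>_graft: "\<Phi> (graft_left P) = - mult_map (graft_left (U P))" for P
  proof (rule lin_eqI[where p = P])
    fix ab :: "forest \<times> forest"
    have "S_tree (B_plus a) * basis b = - mult_map (graft_left (id_S_forest a * basis ({#}, b)))" for a b
      by (simp add: S_tree.simps graft_left_mult_right mult_map_mult)
    then show "\<Phi> (graft_left (basis ab)) = - mult_map (graft_left (U (basis ab)))"
      by (cases ab) (simp add: \<Phi>_def U_def)
  qed (intro linI; simp add: \<Phi>_def U_def)+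
  have U_graft: "U (graft_left P) = tens 1 (\<Phi> (graft_left P)) + graft_left (U P)" for P
  proof (rule lin_eqI[where p = P])
    fix ab :: "forest \<times> forest"
    have "tens (1 :: hopf) p * basis ({#}, b) = tens 1 (p * basis b)" for p and b :: forest
      using tens_mult[of "1 :: hopf" p 1 "basis b"] by (simp add: tens_one_left_basis)
    then show "U (graft_left (basis ab)) = tens 1 (\<Phi> (graft_left (basis ab))) + graft_left (U (basis ab))"
      by (cases ab) (simp add: \<Phi>_def U_def id_S_tree_B_plus graft_left_mult_right distrib_right)
  qed (intro linI; simp add: \<Phi>_def U_def tens_linear scale_distribs)+
  \<comment> \<open>By \<open>\<Phi>_graft\<close>, the value of \<Phi> at B_+ f is B_+ f minus the
    product of the factors of \<open>graft_left (U (coproduct_forest f))\<close>. It vanishes once U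
    gives f \<otimes> 1, which follows from the claim about U for the trees in f.\<close>
  have tree: "\<Phi> (coproduct_tree t) = 0 \<and> U (coproduct_tree t) = basis ({#t#}, {#})" for t
  proof (induction t)
    case (B_plus f)
    have "U (coproduct_forest g) = basis (g, {#})" if "g \<subseteq># f" for g
      using that
    proof (induction g)
      case empty
      then show ?case by (simp add: U_def basis_empty zero_prod_def)
    next
      case (add t g)
      then have "t \<in># f" "g \<subseteq># f"
        by (auto dest: mset_subset_eq_insertD intro: subset_mset.less_imp_le)
      with add.IH B_plus.IH show ?case by (simp add: U_mult mult_single)
    qed
    then have U: "U (coproduct_forest f) = basis (f, {#})" by simp
    have t: "\<Phi> (basis ({#}, g)) = basis g" "U (basis ({#}, g)) = tens 1 (basis g)" for g
      by (simp_all add: \<Phi>_def U_def tens_one_left_basis)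
    have \<Phi>_g: "\<Phi> (graft_left (coproduct_forest f)) = - basis {#B_plus f#}"
      by (simp add: \<Phi>_graft U)
    have "tens (1 :: hopf) (- p) = - tens 1 p" for p :: hopf
      using tens_diff(1)[of "1 :: hopf" 0 p] tens_diff(1)[of "1 :: hopf" 0 "0 :: hopf"] by simp
    then show ?case
      by (simp add: coproduct_tree_B_plus \<Phi>_add U_add t \<Phi>_g U_graft U)
  qed
  have "\<Phi> 1 = 1"
    by (simp add: \<Phi>_def zero_prod_def basis_empty)
  then have "\<Phi> (coproduct_forest f) = (if f = {#} then 1 else 0)"
    using tree by (cases f) (simp_all add: \<Phi>_mult)
  then show ?thesis by (simp add: \<Phi>_def)
qed

section \<open>Grading by the number of vertices and uniqueness of convolution inverses\<close>

primrec tree_degree :: "tree \<Rightarrow> nat" where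
  "tree_degree (B_plus f) = Suc (\<Sum>\<^sub># (image_mset tree_degree f))"

definition degree :: "forest \<Rightarrow> nat" where
  "degree f = (\<Sum>t\<in>#f. tree_degree t)"

lemma degree_simps [simp]:
  "degree {#} = 0" "degree (add_mset t f) = tree_degree t + degree f"
  "degree (f + g) = degree f + degree g"
  by (simp_all add: degree_def)

text \<open>Isolating the term 1 \<otimes> f makes convolution equations solvable by induction on
  the degree. The property passes to products, so trees suffice.\<close>

lemma coproduct_forest_triangular:
  "\<exists>r. coproduct_forest f = basis ({#}, f) + r \<and> (\<forall>(a, b)\<in>Poly_Mapping.keys r. degree b < degree f)"
proof -
  define low :: "nat \<Rightarrow> hopf2 \<Rightarrow> bool" where
    "low n P \<longleftrightarrow> (\<forall>(a, b)\<in>Poly_Mapping.keys P. degree b < n)" for n P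
  define T where "T f P \<longleftrightarrow> (\<exists>r. P = basis ({#}, f) + r \<and> low (degree f) r)" for f P
  have T_mult: "T (f + g) (P * Q)" if PQ: "T f P" "T g Q" for f g P Q
  proof -
    obtain r s where rs: "P = basis ({#}, f) + r" "low (degree f) r"
        "Q = basis ({#}, g) + s" "low (degree g) s"
      using PQ by (auto simp: T_def)
    define t where "t = basis ({#}, f) * s + r * basis ({#}, g) + r * s"
    have add: "low n (p + q)" if "low n p" "low n q" for n p q
      using that Poly_Mapping.keys_add[of p q] by (force simp: low_def)
    have "low (degree (f + g)) (basis ({#}, f) * s)"
      "low (degree (f + g)) (r * basis ({#}, g))" "low (degree (f + g)) (r * s)"
      using rs keys_mult[of "basis ({#}, f)" s] keys_mult[of r "basis ({#}, g)"] keys_mult[of r s]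
      by (fastforce simp: low_def)+
    then have "low (degree (f + g)) t" by (simp add: t_def add)
    moreover have "P * Q = basis ({#}, f + g) + t"
      using mult_single[of "({#}, f)" 1 "({#}, g)" "1 :: rat"]
      by (simp add: rs t_def algebra_simps)
    ultimately show ?thesis by (auto simp: T_def)
  qed
  have one: "T {#} 1" by (simp add: T_def low_def basis_empty)
  have forest: "T f (coproduct_forest f)" if "\<And>t. t \<in># f \<Longrightarrow> T {#t#} (coproduct_tree t)" for f
    using that
  proof (induction f)
    case (add t f)
    then show ?case using T_mult[of "{#t#}" "coproduct_tree t" f] by simp
  qed (simp add: one)
  have "T {#t#} (coproduct_tree t)" for t
  proof (induction t)
    case (B_plus f)
    obtain r where r: "coproduct_forest f = basis ({#}, f) + r" "low (degree f) r"
      using forest[OF B_plus.IH] unfolding T_def by blast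
    \<comment> \<open>Grafting keeps the right factors. Even the leading term 1 \<otimes> f becomes
      low, because B_+ f has one vertex more than f.\<close>
    have "low (Suc (degree f)) (graft_left P)" if "low (Suc (degree f)) P" for P
    proof -
      have "Poly_Mapping.keys (graft_left P) \<subseteq> (\<lambda>(a, b). ({#B_plus a#}, b)) ` Poly_Mapping.keys P"
      proof
        fix k assume "k \<in> Poly_Mapping.keys (graft_left P)"
        then have "\<exists>ab\<in>Poly_Mapping.keys P. k \<in> Poly_Mapping.keys
            (scale (Poly_Mapping.lookup P ab) (case ab of (a, b) \<Rightarrow> basis ({#B_plus a#}, b)))"
          unfolding graft_left_def lin_ext_def using keys_sum by (metis (no_types, lifting) UN_E subsetD)
        then show "k \<in> (\<lambda>(a, b). ({#B_plus a#}, b)) ` Poly_Mapping.keys P"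
          by (force split: if_splits)
      qed
      then show ?thesis using that by (fastforce simp: low_def)
    qed
    moreover have "low (Suc (degree f)) (coproduct_forest f)"
      using r(2) Poly_Mapping.keys_add[of "basis ({#}, f)" r] unfolding r(1)
      by (fastforce simp: low_def)
    ultimately have "low (degree {#B_plus f#}) (graft_left (coproduct_forest f))"
      by (simp add: degree_def)
    then show ?case by (auto simp: T_def coproduct_tree_B_plus)
  qed
  with forest have "T f (coproduct_forest f)" by blast
  then show ?thesis by (simp add: T_def low_def)
qed

text \<open>The term 1 \<otimes> f contributes \<open>g f\<close> and \<open>h f\<close> themselves;
  in all others the right factor has lower degree. Leaving \<open>\<beta>\<close> open covers
  convolution with the identity and with F.\<close>

lemma right_inverse_unique:
  assumes "\<And>p. \<beta> {#} p = p"
    and "\<And>f. lin_ext (\<lambda>(a, b). \<beta> a (g b)) (coproduct_forest f) =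
      lin_ext (\<lambda>(a, b). \<beta> a (h b)) (coproduct_forest f)"
  shows "g f = h f"
proof (induction "degree f" arbitrary: f rule: less_induct)
  case less
  obtain r where r: "coproduct_forest f = basis ({#}, f) + r"
      "\<forall>(a, b)\<in>Poly_Mapping.keys r. degree b < degree f"
    using coproduct_forest_triangular by blast
  have "lin_ext (\<lambda>(a, b). \<beta> a (g b)) r = lin_ext (\<lambda>(a, b). \<beta> a (h b)) r"
    by (rule lin_ext_cong) (use r(2) less in force)
  then show ?case
    using assms(2)[of f] by (simp add: r(1) assms(1))
qed

lemma convolution_id:
  assumes "lin S"
  shows "mult_map (tensor_map S id (coproduct (basis f))) =
      lin_ext (\<lambda>(a, b). S (basis a) * basis b) (coproduct_forest f)"
    "mult_map (tensor_map id S (coproduct (basis f))) =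
      lin_ext (\<lambda>(a, b). basis a * S (basis b)) (coproduct_forest f)"
proof -
  have lin: "lin mult_map" by (intro linI) simp_all
  show "mult_map (tensor_map S id (coproduct (basis f))) =
      lin_ext (\<lambda>(a, b). S (basis a) * basis b) (coproduct_forest f)"
    "mult_map (tensor_map id S (coproduct (basis f))) =
      lin_ext (\<lambda>(a, b). basis a * S (basis b)) (coproduct_forest f)"
    by (simp_all add: coproduct_def tensor_map_def tensor_eq_tens lin_lin_ext[OF lin]
        mult_map_tens case_prod_unfold)
qed

lemma is_antipode_S: "is_antipode (lin_ext S_forest)"
proof -
  have basis: "mult_map (tensor_map (lin_ext S_forest) id (coproduct (basis f))) = scale (counit (basis f)) 1"
    "mult_map (tensor_map id (lin_ext S_forest) (coproduct (basis f))) = scale (counit (basis f)) 1" for f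
  proof -
    have c: "scale (counit (basis f)) 1 = (if f = {#} then 1 else 0)"
      by (simp add: counit_def lookup_single when_def)
    show "mult_map (tensor_map (lin_ext S_forest) id (coproduct (basis f))) = scale (counit (basis f)) 1"
      by (simp only: convolution_id[OF lin_lin_ext_apply] lin_ext_basis mult_map_S_id c)
    have "lin mult_map" by (intro linI) simp_all
    then have "lin_ext (\<lambda>(a, b). basis a * S_forest b) (coproduct_forest f) = mult_map (id_S_forest f)"
      by (simp add: lin_ext_id_S[symmetric] lin_lin_ext mult_map_tens case_prod_unfold)
    then show "mult_map (tensor_map id (lin_ext S_forest) (coproduct (basis f))) = scale (counit (basis f)) 1"
      by (simp only: convolution_id[OF lin_lin_ext_apply] lin_ext_basis mult_map_id_S c)
  qed
  have "mult_map (tensor_map (lin_ext S_forest) id (coproduct p)) = scale (counit p) 1"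
    "mult_map (tensor_map id (lin_ext S_forest) (coproduct p)) = scale (counit p) 1" for p
    by (rule lin_eqI[where p = p], (intro linI; simp add: tensor_map_def coproduct_def counit_def lookup_add scale_distribs)+, 
        rule basis)+
  moreover have "Vector_Spaces.linear scale scale (lin_ext S_forest)"
    by (simp add: Vector_Spaces.linear_iff vector_space_scale)
  ultimately show ?thesis by (simp add: is_antipode_def)
qed

lemma antipode_eq: "antipode = lin_ext S_forest"
  unfolding antipode_def
proof (rule the_equality, rule is_antipode_S)
  fix S assume S: "is_antipode S"
  have lin: "lin S"
    using S by (simp add: is_antipode_def Vector_Spaces.linear_iff lin_def)
  have "S (basis f) = S_forest f" for f
  proof (rule right_inverse_unique[where \<beta> = "\<lambda>a q. basis a * q"])
    fix f
    have "mult_map (tensor_map id S (coproduct (basis f))) =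
        mult_map (tensor_map id (lin_ext S_forest) (coproduct (basis f)))"
      using S is_antipode_S by (simp add: is_antipode_def)
    then show "lin_ext (\<lambda>(a, b). basis a * S (basis b)) (coproduct_forest f) =
        lin_ext (\<lambda>(a, b). basis a * S_forest b) (coproduct_forest f)"
      by (simp only: convolution_id[OF lin] convolution_id[OF lin_lin_ext_apply] lin_ext_basis)
  qed (simp add: basis_empty)
  then show "S = lin_ext S_forest"
    using lin_eqI[OF lin lin_lin_ext_apply, of S_forest] by (auto simp: fun_eq_iff)
qed

section \<open>Transport of the antipode along F\<close>

lemma F_mult: "F (p * q) = F p \<diamondop> F q"
  unfolding F_def by (rule lin_ext_hom[OF bilin_diamond]) (rule F_forest_rules(4))

lemma F_one: "F 1 = 1"
  by (simp add: F_def F_forest_rules(1))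

text \<open>Both sides are right convolution inverses of F: the left because F is multiplicative,
  the right by \<open>F_conv_sigma\<close>.\<close>

lemma F_S_forest: "F (S_forest f) = sigma (F_forest f)"
proof (rule right_inverse_unique[where \<beta> = "\<lambda>a q. F_forest a \<diamondop> q"])
  fix f
  have lin: "lin (\<lambda>P. F (mult_map P))" by (intro linI) (simp_all add: F_def)
  have "lin_ext (\<lambda>(a, b). F_forest a \<diamondop> F (S_forest b)) (coproduct_forest f) =
      F (mult_map (id_S_forest f))"
    by (simp add: lin_ext_id_S[symmetric] lin_lin_ext[OF lin] mult_map_tens F_mult case_prod_unfold)
      (simp add: F_def)
  also have "\<dots> = (if f = {#} then 1 else 0)"
    \<comment> \<open>The instance with scalar 0 yields F 0 = 0, for nonempty forests.\<close>
    using F_forest_rules(1) lin_ext_scale[of F_forest 0 0]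
    by (simp add: mult_map_id_S F_def)
  finally show "lin_ext (\<lambda>(a, b). F_forest a \<diamondop> F (S_forest b)) (coproduct_forest f) =
      lin_ext (\<lambda>(a, b). F_forest a \<diamondop> sigma (F_forest b)) (coproduct_forest f)"
    by (simp only: F_conv_sigma)
qed (simp add: F_forest_rules(1) diamond_one_left)

text \<open>On trees F S is \<open>sigma\<close> applied to \<open>lam (F_forest f)\<close>. The
  cases \<open>sigma_lam_one\<close> and \<open>sigma_lam_y\<close> are the two clauses of
  \<open>G_tree\<close>.\<close>

lemma G_forest_eq: "G_forest f = F (S_forest f)"
proof -
  have forest: "G_forest f = F (S_forest f)" if "\<And>t. t \<in># f \<Longrightarrow> G_tree t = F (S_tree t)" for f
    using that by (induction f) (simp_all add: G_forest_def F_mult F_one del: G_tree.simps)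
  have "G_tree t = F (S_tree t)" for t
  proof (induction t)
    case (B_plus f)
    have "F (S_tree (B_plus f)) = sigma (lam (F_forest f))"
      using F_S_forest[of "{#B_plus f#}"]
      by (simp add: F_forest_add_mset F_forest_rules(1) diamond_one_right F_tree_eq_lam del: F_tree.simps)
    moreover have "G_forest f = sigma (F_forest f)"
      using forest B_plus.IH F_S_forest by simp
    ultimately show ?case
      by (cases f rule: F_forest_cases)
        (simp_all add: sigma_lam_one sigma_lam_y R_def flip: G_forest_def)
  qed
  with forest show ?thesis by blast
qed

theorem corollary1p3:
  fixes f :: hopf
  shows "G f = F (antipode f)"
proof -
  have "lin F" by (simp add: F_def)
  moreover have "G_forest = (\<lambda>f. F (S_forest f))"
    by (simp add: fun_eq_iff G_forest_eq)
  ultimately show ?thesis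
    by (simp add: antipode_eq G_def lin_lin_ext)
qed

end
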